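(* Let $L,W,S,B>0$ be constants, $\Phi=[0,1]^{d_{\mathrm e}}$ and $\Psi=[0,1]^{M\times d_{\mathrm e}}\times[-B,B]^{D\times d_{\mathrm e}}\times[-B,B]^{D}\times\mathcal W(L,W,S,B)$. For $\phi\in\Phi$, $\psi=(\boldsymbol V_X,\boldsymbol A_0,\boldsymbol b_0,\omega)\in\Psi$ and $k\in\{1,\dots,K\}$, let $p_{\phi,\psi}(\boldsymbol x\vert k)$ be the autoregressive conditional distribution on $\{1,\dots,M\}^D$ defined in the context, with label embedding $\phi$. Let the true conditional distributions be $p^*_{X\vert k}=p_{\phi_k^*,\psi^*}(\cdot\vert k)$ with $\phi_k^*\in\Phi$, $\psi^*\in\Psi$, let $\{(\boldsymbol x_i,y_i)\}_{i=1}^n$ be i.i.d. from $p^*_{X,Y}=p^*_{X\vert Y}p^*_Y$, and let $\hat p^{\mathrm{single}}_{X\vert Y}$ be a maximizer of $\prod_{i=1}^n p_{X\vert Y}(\boldsymbol x_i\vert y_i)$ over $$\mathcal P^{\mathrm{single}}_{X\vert Y}=\Big\{\textstyle\prod_{k=1}^K (p_{\phi_k,\psi_k}(\boldsymbol x\vert k))^{\mathbb I(y=k)}:\phi_1,\dots,\phi_K\in\Phi,\ \psi_1,\dots,\psi_K\in\Psi\Big\}.$$ Then for any $0<\delta\le1/2$, with probability at least $1-\delta$, $$\mathcal R_{\overline{\mathrm{TV}}}(\hat p^{\mathrm{single}}_{X\vert Y})=\tilde{\mathcal O}\left(\sqrt{\frac{KL\,(S+D+(D+M+1)d_{\mathrm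 e})}{n}}\right).$$
   Context: $\mathscr X=\{1,\dots,M\}^D$, $\mathscr Y=\{1,\dots,K\}$, $p_Y^*$ is a distribution on $\mathscr Y$, $\mathbb I$ is the indicator function. MLPs: $\mathcal W(L,W,S,B)$ is the set of $\{(\boldsymbol A^{(l)},\boldsymbol b^{(l)})\}_{l=1}^L$ with $\boldsymbol A^{(l)}\in\mathbb R^{W_l\times W_{l-1}}$, $\boldsymbol b^{(l)}\in\mathbb R^{W_l}$, $\max_l W_l\le W$, $\sum_{l=1}^L(\|\boldsymbol A^{(l)}\|_0+\|\boldsymbol b^{(l)}\|_0)\le S$ (number of nonzero entries), $\max_l \|\boldsymbol A^{(l)}\|_\infty\vee\|\boldsymbol b^{(l)}\|_\infty\le B$ (entrywise maximum absolute value). For $\omega\in\mathcal W(L,W,S,B)$, $\boldsymbol f_\omega(\boldsymbol x)=(\boldsymbol A^{(L)}\mathrm{ReLU}(\cdot)+\boldsymbol b^{(L)})\circ\cdots\circ(\boldsymbol A^{(2)}\mathrm{ReLU}(\cdot)+\boldsymbol b^{(2)})\circ(\boldsymbol A^{(1)}\boldsymbol x+\boldsymbol b^{(1)})$ with entrywise $\mathrm{ReLU}(x)=\max\{0,x\}$. Here $W_0=D$ and $W_L=M$. Autoregressive model: given $\phi\in[0,1]^{d_{\mathrm e}}$ (the embedding of label $k$) and $\boldsymbol V_X\in[0,1]^{M\times d_{\mathrm e}}$, let $\boldsymbol E(\boldsymbol x)\in[0,1]^{D\times d_{\mathrm e}}$ be the matrix with rows $\phi,\boldsymbol V_X[x_1,:],\dots,\boldsymbol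 V_X[x_{D-1},:]$. For $\boldsymbol A_0\in\mathbb R^{D\times d_{\mathrm e}}$, $\boldsymbol b_0\in\mathbb R^D$, let $\boldsymbol v(\boldsymbol x)\in[0,1]^D$ have $j$-th entry $\sigma(\boldsymbol A_0[j,:]\boldsymbol E(\boldsymbol x)[j,:]^\top+\boldsymbol b_0[j])$, $\sigma(t)=1/(1+e^{-t})$. For $d\in\{1,\dots,D\}$ let $\boldsymbol v^{\backslash \boldsymbol 0_{D-d}}$ be $\boldsymbol v$ with its last $D-d$ entries replaced by $0$. Put $\boldsymbol\rho(\boldsymbol x_{<d})=\mathrm{softmax}(\boldsymbol f_\omega(\boldsymbol v^{\backslash \boldsymbol 0_{D-d}}(\boldsymbol x)))\in\mathbb R^M$ and $p_{\phi,\psi}(\boldsymbol x\vert k)=\prod_{d=1}^D \boldsymbol\rho(\boldsymbol x_{<d})[x_d]$. Average TV error: $\mathcal R_{\overline{\mathrm{TV}}}(\hat p_{X\vert Y})=\mathbb E_{Y\sim p_Y^*}\left[\frac12\sum_{\boldsymbol x\in\mathscr X}\left|\hat p_{X\vert Y}(\boldsymbol x\vert Y)-p^*_{X\vert Y}(\boldsymbol x\vert Y)\right|\right]$. $\tilde{\mathcal O}(b)$ means bounded above by $b$ up to absolute constants and logarithmic factors: there are absolute constants $C,c>0$ such that the left-hand side is at most $C\,b\,(\log(2+n+K+D+M+d_{\mathrm e}+L+W+S+B+1/\delta))^{c}$. *)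

theory Defs
  imports
    "HOL-Probability.Probability"
    "Jordan_Normal_Form.Matrix"
begin

unbundle no vec_syntax

no_notation inner (infix "\<bullet>" 70)

definition mat_box :: "nat \<Rightarrow> nat \<Rightarrow> real \<Rightarrow> real \<Rightarrow> real mat set" where
  "mat_box m n lo hi = {A \<in> carrier_mat m n. \<forall>i<m. \<forall>j<n. A $$ (i, j) \<in> {lo..hi}}"

definition vec_box :: "nat \<Rightarrow> real \<Rightarrow> real \<Rightarrow> real vec set" where
  "vec_box n lo hi = {v \<in> carrier_vec n. \<forall>i<n. v $ i \<in> {lo..hi}}"

definition nnz_mat :: "real mat \<Rightarrow> nat" where
  "nnz_mat A = card {(i, j). i < dim_row A \<and> j < dim_col A \<and> A $$ (i, j) \<noteq> 0}"

definition nnz_vec :: "real vec \<Rightarrow> nat" where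
  "nnz_vec v = card {i. i < dim_vec v \<and> v $ i \<noteq> 0}"

type_synonym mlp_params = "(real mat \<times> real vec) list"

definition relu_vec :: "real vec \<Rightarrow> real vec" where
  "relu_vec = map_vec (\<lambda>t. max 0 t)"

text \<open>No activation is applied to the input of the first layer.\<close>

fun mlp :: "mlp_params \<Rightarrow> real vec \<Rightarrow> real vec" where
  "mlp [] x = x"
| "mlp ((A, b) # ls) x = fold (\<lambda>(A', b') z. A' *\<^sub>v relu_vec z + b') ls (A *\<^sub>v x + b)"

text \<open>
  Index \<open>l\<close> of the list holds the layer from width \<open>w l\<close> to width \<open>w (Suc l)\<close>. The bound
  \<open>W\<close> ranges over the widths \<open>w 1, \<dots>, w L\<close>: it constrains \<open>d_out\<close> but not \<open>d_in\<close>.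
\<close>

definition mlp_class :: "nat \<Rightarrow> nat \<Rightarrow> nat \<Rightarrow> nat \<Rightarrow> nat \<Rightarrow> real \<Rightarrow> mlp_params set" where
  "mlp_class d_in d_out L W S B = {\<omega>. length \<omega> = L \<and>
     (\<exists>w :: nat \<Rightarrow> nat. w 0 = d_in \<and> w L = d_out \<and>
        (\<forall>l\<in>{1..L}. 1 \<le> w l \<and> w l \<le> W) \<and>
        (\<forall>l<L. fst (\<omega> ! l) \<in> mat_box (w (Suc l)) (w l) (- B) B \<and>
               snd (\<omega> ! l) \<in> vec_box (w (Suc l)) (- B) B)) \<and>
     (\<Sum>(A, b)\<leftarrow>\<omega>. nnz_mat A + nnz_vec b) \<le> S}"

definition sigmoid :: "real \<Rightarrow> real" where
  "sigmoid t = 1 / (1 + exp (- t))"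

definition softmax :: "real vec \<Rightarrow> real vec" where
  "softmax z = vec (dim_vec z) (\<lambda>i. exp (z $ i) / (\<Sum>j<dim_vec z. exp (z $ j)))"

text \<open>
  Tokens are the numbers \<open>1, \<dots>, M\<close>, while matrix, vector and list indices start at \<open>0\<close>: the
  token in position \<open>d \<in> {1..D}\<close> of \<open>x\<close> is \<open>x ! (d - 1)\<close>, and token \<open>m\<close> has index \<open>m - 1\<close>.
\<close>

definition token_seqs :: "nat \<Rightarrow> nat \<Rightarrow> nat list set" where
  "token_seqs D M = {x. length x = D \<and> set x \<subseteq> {1..M}}"

definition embedding :: "nat \<Rightarrow> nat \<Rightarrow> real vec \<Rightarrow> real mat \<Rightarrow> nat list \<Rightarrow> real mat" where
  "embedding D de \<phi> V x =
     mat D de (\<lambda>(j, c). if j = 0 then \<phi> $ c else V $$ (x ! (j - 1) - 1, c))"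

type_synonym ar_params = "real mat \<times> real mat \<times> real vec \<times> mlp_params"

definition hidden_vec :: "nat \<Rightarrow> nat \<Rightarrow> real vec \<Rightarrow> ar_params \<Rightarrow> nat list \<Rightarrow> real vec" where
  "hidden_vec D de \<phi> = (\<lambda>(V, A0, b0, \<omega>) x.
     vec D (\<lambda>j. sigmoid (row A0 j \<bullet> row (embedding D de \<phi> V x) j + b0 $ j)))"

definition mask_after :: "nat \<Rightarrow> real vec \<Rightarrow> real vec" where
  "mask_after d v = vec (dim_vec v) (\<lambda>j. if j < d then v $ j else 0)"

text \<open>The conditional distribution of the \<open>d\<close>-th token; it depends on the first \<open>d - 1\<close> tokens of \<open>x\<close> only.\<close>

definition next_token :: "nat \<Rightarrow> nat \<Rightarrow> real vec \<Rightarrow> ar_params \<Rightarrow> nat \<Rightarrow> nat list \<Rightarrow> real vec" where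
  "next_token D de \<phi> = (\<lambda>(V, A0, b0, \<omega>) d x.
     softmax (mlp \<omega> (mask_after d (hidden_vec D de \<phi> (V, A0, b0, \<omega>) x))))"

definition ar_prob :: "nat \<Rightarrow> nat \<Rightarrow> real vec \<Rightarrow> ar_params \<Rightarrow> nat list \<Rightarrow> real" where
  "ar_prob D de \<phi> \<psi> x = (\<Prod>d\<in>{1..D}. next_token D de \<phi> \<psi> d x $ (x ! (d - 1) - 1))"

definition Phi_set :: "nat \<Rightarrow> real vec set" where
  "Phi_set de = vec_box de 0 1"

definition Psi_set :: "nat \<Rightarrow> nat \<Rightarrow> nat \<Rightarrow> nat \<Rightarrow> nat \<Rightarrow> nat \<Rightarrow> real \<Rightarrow> ar_params set" where
  "Psi_set D M de L W S B =
     mat_box M de 0 1 \<times> mat_box D de (- B) B \<times> vec_box D (- B) B \<times> mlp_class D M L W S B"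

lemma sum_token_seqs_prod:
  fixes f :: "nat \<Rightarrow> nat list \<Rightarrow> nat \<Rightarrow> real"
  assumes "\<And>d x. (\<Sum>m\<in>{1..M}. f d x m) = 1"
  shows "(\<Sum>x\<in>token_seqs D M. \<Prod>d\<in>{1..D}. f d (take (d - 1) x) (x ! (d - 1))) = 1"
proof (induction D)
  case 0
  have "token_seqs 0 M = {[]}" by (auto simp: token_seqs_def)
  then show ?case by simp
next
  case (Suc D)
  let ?g = "\<lambda>D x. \<Prod>d\<in>{1..D}. f d (take (d - 1) x) (x ! (d - 1))"
  have bij: "bij_betw (\<lambda>(x, m). x @ [m]) (token_seqs D M \<times> {1..M}) (token_seqs (Suc D) M)"
    unfolding bij_betw_def
  proof
    show "inj_on (\<lambda>(x, m). x @ [m]) (token_seqs D M \<times> {1..M})" by (auto simp: inj_on_def)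
    show "(\<lambda>(x, m). x @ [m]) ` (token_seqs D M \<times> {1..M}) = token_seqs (Suc D) M"
    proof (intro equalityI subsetI)
      fix y assume "y \<in> token_seqs (Suc D) M"
      then have y: "length y = Suc D" "set y \<subseteq> {1..M}" by (auto simp: token_seqs_def)
      then obtain x m where "y = x @ [m]" by (metis length_Suc_conv_rev)
      with y show "y \<in> (\<lambda>(x, m). x @ [m]) ` (token_seqs D M \<times> {1..M})"
        by (auto simp: token_seqs_def image_iff intro!: bexI[of _ "(x, m)"])
    qed (auto simp: token_seqs_def)
  qed
  have step: "?g (Suc D) (x @ [m]) = ?g D x * f (Suc D) x m" if "x \<in> token_seqs D M" for x m
  proof -
    have len: "length x = D" using that by (simp add: token_seqs_def)
    have "?g D (x @ [m]) = ?g D x"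
      by (rule prod.cong) (auto simp: len nth_append)
    moreover have "(x @ [m]) ! D = m" using len by (simp add: nth_append)
    ultimately show ?thesis by (simp add: len)
  qed
  have "(\<Sum>y\<in>token_seqs (Suc D) M. ?g (Suc D) y)
      = (\<Sum>(x, m)\<in>token_seqs D M \<times> {1..M}. ?g (Suc D) (x @ [m]))"
    by (subst sum.reindex_bij_betw[OF bij, symmetric]) (simp add: case_prod_unfold)
  also have "\<dots> = (\<Sum>x\<in>token_seqs D M. \<Sum>m\<in>{1..M}. ?g (Suc D) (x @ [m]))"
    by (rule sum.cartesian_product[symmetric])
  also have "\<dots> = (\<Sum>x\<in>token_seqs D M. ?g D x * (\<Sum>m\<in>{1..M}. f (Suc D) x m))"
    by (intro sum.cong refl) (simp only: step sum_distrib_left)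
  also have "\<dots> = 1" using Suc assms by simp
  finally show ?case .
qed

lemma dim_mlp:
  assumes "\<omega> \<in> mlp_class d_in d_out L W S B" "L \<ge> 1"
  shows "dim_vec (mlp \<omega> x) = d_out"
proof -
  have last: "dim_vec (fold (\<lambda>(A', b') z. A' *\<^sub>v relu_vec z + b') ls z)
      = (if ls = [] then dim_vec z else dim_vec (snd (last ls)))" for ls :: mlp_params and z
    by (induction ls arbitrary: z) auto
  obtain w where len: "length \<omega> = L" and w: "w L = d_out"
      "\<And>l. l < L \<Longrightarrow> snd (\<omega> ! l) \<in> vec_box (w (Suc l)) (- B) B"
    using assms by (auto simp: mlp_class_def)
  have "snd (\<omega> ! (L - 1)) \<in> vec_box d_out (- B) B"
    using w(2)[of "L - 1"] w(1) assms(2) by simp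
  then have "dim_vec (snd (\<omega> ! (L - 1))) = d_out" by (simp add: vec_box_def)
  moreover have "\<omega> \<noteq> []" using len assms by auto
  ultimately have "dim_vec (snd (last \<omega>)) = d_out" by (simp add: last_conv_nth len)
  with \<open>\<omega> \<noteq> []\<close> show ?thesis
    by (cases \<omega>) (auto simp: last split: if_splits)
qed

lemma next_token_take: "next_token D de \<phi> \<psi> d x = next_token D de \<phi> \<psi> d (take (d - 1) x)"
proof -
  obtain V A0 b0 \<omega> where \<psi>: "\<psi> = (V, A0, b0, \<omega>)" by (metis prod_cases4)
  have "row (embedding D de \<phi> V x) j = row (embedding D de \<phi> V (take (d - 1) x)) j"
    if "j < D" "j < d" for j
    using that by (intro eq_vecI) (auto simp: embedding_def)
  then have "mask_after d (hidden_vec D de \<phi> \<psi> x)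
      = mask_after d (hidden_vec D de \<phi> \<psi> (take (d - 1) x))"
    unfolding \<psi> by (intro eq_vecI) (auto simp: mask_after_def hidden_vec_def)
  then show ?thesis by (simp add: next_token_def \<psi>)
qed

lemma ar_prob_nonneg:
  assumes "\<psi> \<in> Psi_set D M de L W S B" "L \<ge> 1" "x \<in> token_seqs D M"
  shows "ar_prob D de \<phi> \<psi> x \<ge> 0"
proof -
  obtain V A0 b0 \<omega> where \<psi>: "\<psi> = (V, A0, b0, \<omega>)" by (metis prod_cases4)
  with assms have \<omega>: "\<omega> \<in> mlp_class D M L W S B" by (auto simp: Psi_set_def)
  have "x ! (d - 1) - 1 < M" if "d \<in> {1..D}" for d
  proof -
    have "x ! (d - 1) \<in> set x" using that assms(3) by (intro nth_mem) (auto simp: token_seqs_def)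
    then have "x ! (d - 1) \<in> {1..M}" using assms(3) by (auto simp: token_seqs_def)
    then show ?thesis by auto
  qed
  then show ?thesis
    by (auto simp: ar_prob_def next_token_def \<psi> softmax_def dim_mlp[OF \<omega> assms(2)]
        intro!: prod_nonneg divide_nonneg_nonneg sum_nonneg)
qed

lemma sum_ar_prob:
  assumes "\<psi> \<in> Psi_set D M de L W S B" "L \<ge> 1" "M \<ge> 1"
  shows "(\<Sum>x\<in>token_seqs D M. ar_prob D de \<phi> \<psi> x) = 1"
proof -
  obtain V A0 b0 \<omega> where \<psi>: "\<psi> = (V, A0, b0, \<omega>)" by (metis prod_cases4)
  with assms have \<omega>: "\<omega> \<in> mlp_class D M L W S B" by (auto simp: Psi_set_def)
  have one: "(\<Sum>m\<in>{1..M}. next_token D de \<phi> \<psi> d x $ (m - 1)) = 1" for d x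
  proof -
    define z where "z = mlp \<omega> (mask_after d (hidden_vec D de \<phi> \<psi> x))"
    have dz: "dim_vec z = M" by (simp add: z_def dim_mlp[OF \<omega> assms(2)])
    have pos: "(\<Sum>j<M. exp (z $ j)) > 0" using assms(3)
      by (intro sum_pos) (auto simp: lessThan_empty_iff)
    have "(\<Sum>m\<in>{1..M}. next_token D de \<phi> \<psi> d x $ (m - 1)) = (\<Sum>m<M. softmax z $ m)"
      by (rule sum.reindex_bij_witness[of _ Suc "\<lambda>m. m - 1"])
         (auto simp: next_token_def \<psi> z_def)
    also have "\<dots> = (\<Sum>m<M. exp (z $ m) / (\<Sum>j<M. exp (z $ j)))"
      by (intro sum.cong) (auto simp: softmax_def dz)
    also have "\<dots> = 1" using pos by (simp add: sum_divide_distrib[symmetric])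
    finally show ?thesis .
  qed
  have "(\<Sum>x\<in>token_seqs D M. \<Prod>d\<in>{1..D}. next_token D de \<phi> \<psi> d (take (d - 1) x) $ (x ! (d - 1) - 1)) = 1"
    using sum_token_seqs_prod[where M = M and f = "\<lambda>d x m. next_token D de \<phi> \<psi> d x $ (m - 1)"] one by simp
  then show ?thesis by (simp only: ar_prob_def next_token_take[symmetric])
qed

definition ar_pmf :: "nat \<Rightarrow> nat \<Rightarrow> nat \<Rightarrow> real vec \<Rightarrow> ar_params \<Rightarrow> nat list pmf" where
  "ar_pmf D M de \<phi> \<psi> = embed_pmf (\<lambda>x. if x \<in> token_seqs D M then ar_prob D de \<phi> \<psi> x else 0)"

lemma finite_token_seqs: "finite (token_seqs D M)"
  using finite_lists_length_eq[of "{1..M}" D] by (simp add: token_seqs_def conj_commute)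

lemma pmf_ar_pmf:
  assumes "\<psi> \<in> Psi_set D M de L W S B" "L \<ge> 1" "M \<ge> 1"
  shows "pmf (ar_pmf D M de \<phi> \<psi>) x = (if x \<in> token_seqs D M then ar_prob D de \<phi> \<psi> x else 0)"
  unfolding ar_pmf_def
proof (rule pmf_embed_pmf)
  let ?f = "\<lambda>x. if x \<in> token_seqs D M then ar_prob D de \<phi> \<psi> x else 0"
  show nn: "\<And>x. 0 \<le> ?f x" using ar_prob_nonneg[OF assms(1,2)] by auto
  have "(\<integral>\<^sup>+x. ennreal (?f x) \<partial>count_space UNIV) = (\<Sum>x\<in>token_seqs D M. ennreal (?f x))"
    by (rule nn_integral_count_space'[OF finite_token_seqs]) auto
  also have "\<dots> = ennreal (\<Sum>x\<in>token_seqs D M. ?f x)" using nn by (rule sum_ennreal)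
  also have "(\<Sum>x\<in>token_seqs D M. ?f x) = 1" using sum_ar_prob[OF assms] by simp
  finally show "(\<integral>\<^sup>+x. ennreal (?f x) \<partial>count_space UNIV) = 1" by simp
qed

definition joint_pmf ::
  "nat \<Rightarrow> nat \<Rightarrow> nat \<Rightarrow> nat pmf \<Rightarrow> (nat \<Rightarrow> real vec) \<Rightarrow> ar_params \<Rightarrow> (nat list \<times> nat) pmf" where
  "joint_pmf D M de pY \<phi> \<psi> = bind_pmf pY (\<lambda>k. map_pmf (\<lambda>x. (x, k)) (ar_pmf D M de (\<phi> k) \<psi>))"

definition iid_pmf :: "nat \<Rightarrow> 'a pmf \<Rightarrow> (nat \<Rightarrow> 'a) pmf" where
  "iid_pmf n p = Pi_pmf {..<n} undefined (\<lambda>_. p)"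

definition P_single ::
  "nat \<Rightarrow> nat \<Rightarrow> nat \<Rightarrow> nat \<Rightarrow> nat \<Rightarrow> nat \<Rightarrow> nat \<Rightarrow> real \<Rightarrow> (nat list \<Rightarrow> nat \<Rightarrow> real) set" where
  "P_single K D M de L W S B =
     {\<lambda>x y. \<Prod>k\<in>{1..K}. ar_prob D de (\<phi> k) (\<psi> k) x ^ of_bool (y = k) | \<phi> \<psi>.
        \<forall>k\<in>{1..K}. \<phi> k \<in> Phi_set de \<and> \<psi> k \<in> Psi_set D M de L W S B}"

definition is_mle ::
  "('x \<Rightarrow> 'y \<Rightarrow> real) set \<Rightarrow> nat \<Rightarrow> (nat \<Rightarrow> 'x \<times> 'y) \<Rightarrow> ('x \<Rightarrow> 'y \<Rightarrow> real) \<Rightarrow> bool" where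
  "is_mle P n s = is_arg_max (\<lambda>p. \<Prod>i<n. p (fst (s i)) (snd (s i))) (\<lambda>p. p \<in> P)"

definition avg_tv ::
  "'x set \<Rightarrow> 'y pmf \<Rightarrow> ('x \<Rightarrow> 'y \<Rightarrow> real) \<Rightarrow> ('x \<Rightarrow> 'y \<Rightarrow> real) \<Rightarrow> real" where
  "avg_tv X pY p q = measure_pmf.expectation pY (\<lambda>y. 1 / 2 * (\<Sum>x\<in>X. \<bar>p x y - q x y\<bar>))"

end

theory Submission
  imports Defs
begin

text \<open>
  Rounding every parameter towards \<open>0\<close> to a multiple of a small \<open>\<eta>\<close> neither leaves the parameter
  boxes nor creates nonzero entries, and it changes the logits by at most \<open>Q ^ L\<close> times a multiple of
  \<open>\<eta>\<close>, where \<open>Q = (W + D + 1) (1 + B)\<close>. With \<open>ln (1 / \<eta>)\<close> of order \<open>L\<close> up to logarithms, every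
  \<open>ln p\<close> moves by at most \<open>1 / n\<close>, so the rounded model of the maximizer has likelihood at least
  \<open>exp (- 1)\<close> times that of the truth. By Markov's inequality for the square root of the likelihood
  ratio, a fixed model at total variation distance more than \<open>\<tau>\<close> from the truth does so with
  probability at most \<open>exp (1 / 2 - n \<tau>\<^sup>2 / 2)\<close>. A union bound over the rounded models, whose number has
  logarithm of order \<open>K L (S + D + (D + M + 1) de)\<close> up to logarithms, gives the rate.
\<close>

subsection \<open>Likelihood ratios\<close>

text \<open>No count of samples per label is needed: multiplying every conditional model by the true
  label law \<open>pY\<close> turns the averaged distance into the total variation distance of joint
  laws, and the same factor on both sides leaves the comparison of likelihoods intact. Two
  requirements shape the cover. Its members must be probability distributions, because the bound by
  the Hellinger affinity uses total mass 1; this is why the rounded parameters have to stay inside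
  the model class. And they must approximate a model in ratio, not only in absolute value, because
  products of \<open>n\<close> possibly tiny probabilities are compared; softmax turns an additive
  error of the logits into such a ratio. The factor \<open>L\<close> of the rate is the price of
  composition: the grid has to resolve an error that is amplified once per layer, so each coordinate
  costs about \<open>L\<close> logarithms. The factor \<open>K\<close> counts the separate models,
  \<open>S\<close> the network entries, and \<open>D + (D + M + 1) de\<close> the entries of
  \<open>b0\<close>, \<open>A0\<close>, \<open>V\<close> and the embedding.\<close>

lemma tv_hellinger_affinity:
  fixes p q :: "'a \<Rightarrow> real"
  assumes "\<And>x. x \<in> A \<Longrightarrow> 0 \<le> p x" "\<And>x. x \<in> A \<Longrightarrow> 0 \<le> q x"
    and "(\<Sum>x\<in>A. p x) = 1" "(\<Sum>x\<in>A. q x) = 1"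
  shows "(1 / 2 * (\<Sum>x\<in>A. \<bar>q x - p x\<bar>))\<^sup>2 \<le> 1 - (\<Sum>x\<in>A. sqrt (p x * q x))\<^sup>2"
proof -
  define \<rho> where "\<rho> = (\<Sum>x\<in>A. sqrt (p x * q x))"
  \<comment> \<open>Cauchy-Schwarz applied to this factorization gives the product
    \<open>(2 - 2 * \<rho>) * (2 + 2 * \<rho>)\<close>, hence a bound in \<open>1 - \<rho>\<close>
    squared rather than in \<open>1 - \<rho>\<close>.\<close>
  have eq: "\<bar>q x - p x\<bar> = \<bar>sqrt (q x) - sqrt (p x)\<bar> * (sqrt (q x) + sqrt (p x))" if "x \<in> A" for x
  proof -
    have "q x - p x = (sqrt (q x) - sqrt (p x)) * (sqrt (q x) + sqrt (p x))"
      using assms(1,2)[OF that] by (simp add: algebra_simps)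
    then show ?thesis using assms(1,2)[OF that] by (simp add: abs_mult)
  qed
  have m: "(\<Sum>x\<in>A. \<bar>sqrt (q x) - sqrt (p x)\<bar>\<^sup>2) = 2 - 2 * \<rho>"
  proof -
    have "(\<Sum>x\<in>A. \<bar>sqrt (q x) - sqrt (p x)\<bar>\<^sup>2) = (\<Sum>x\<in>A. q x + p x - 2 * sqrt (p x * q x))"
      using assms(1,2) by (intro sum.cong) (auto simp: power2_diff real_sqrt_mult)
    then show ?thesis
      by (simp add: sum.distrib sum_subtractf assms(3,4) \<rho>_def sum_distrib_left)
  qed
  have p: "(\<Sum>x\<in>A. (sqrt (q x) + sqrt (p x))\<^sup>2) = 2 + 2 * \<rho>"
  proof -
    have "(\<Sum>x\<in>A. (sqrt (q x) + sqrt (p x))\<^sup>2) = (\<Sum>x\<in>A. q x + p x + 2 * sqrt (p x * q x))"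
      using assms(1,2) by (intro sum.cong) (auto simp: power2_sum real_sqrt_mult)
    then show ?thesis
      by (simp add: sum.distrib assms(3,4) \<rho>_def sum_distrib_left)
  qed
  have "(\<Sum>x\<in>A. \<bar>q x - p x\<bar>)\<^sup>2 \<le> (2 - 2 * \<rho>) * (2 + 2 * \<rho>)"
    using Cauchy_Schwarz_ineq_sum[of "\<lambda>x. \<bar>sqrt (q x) - sqrt (p x)\<bar>" "\<lambda>x. sqrt (q x) + sqrt (p x)" A]
    unfolding m p by (simp add: eq)
  then show ?thesis unfolding \<rho>_def[symmetric]
    by (simp add: power_mult_distrib power2_eq_square algebra_simps)
qed

lemma real_sqrt_prod: "sqrt (\<Prod>i\<in>I. f i) = (\<Prod>i\<in>I. sqrt (f i))"
  by (induction I rule: infinite_finite_induct) (auto simp: real_sqrt_mult)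

text \<open>The likelihood ratio itself only has expectation at most 1, which gives no decay. Its
  square root has expectation at most the affinity \<open>\<rho>\<close>, which is below 1 when the
  laws are apart, and independence raises this to the power \<open>n\<close>.\<close>

lemma likelihood_ratio_tail:
  fixes p :: "'a pmf" and q :: "'a \<Rightarrow> real"
  assumes "finite A" "set_pmf p \<subseteq> A" "\<And>x. x \<in> A \<Longrightarrow> 0 \<le> q x" "(\<Sum>x\<in>A. q x) = 1" "0 \<le> \<tau>"
    and tv: "\<tau> < 1 / 2 * (\<Sum>x\<in>A. \<bar>q x - pmf p x\<bar>)"
  shows "measure_pmf.prob (iid_pmf n p) {s. exp (- 1) * (\<Prod>i<n. pmf p (s i)) \<le> (\<Prod>i<n. q (s i))}
    \<le> exp (1 / 2 - real n * \<tau>\<^sup>2 / 2)"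
proof -
  define P where "P = iid_pmf n p"
  define f where "f x = sqrt (q x / pmf p x)" for x
  define \<rho> where "\<rho> = (\<Sum>x\<in>A. sqrt (pmf p x * q x))"
  have fin: "finite (set_pmf p)" using assms(1,2) finite_subset by blast
  have f0: "f x \<ge> 0" if "x \<in> A" for x using assms(3)[OF that] by (simp add: f_def)
  have \<rho>0: "0 \<le> \<rho>" unfolding \<rho>_def using assms(3) by (intro sum_nonneg) auto
  have setP: "s i \<in> set_pmf p" if "s \<in> set_pmf P" "i < n" for s i
    using that set_Pi_pmf[of "{..<n}" undefined "\<lambda>_. p"] by (auto simp: P_def iid_pmf_def PiE_dflt_def)
  have sum1: "(\<Sum>x\<in>A. pmf p x) = 1" using assms(1,2) by (rule sum_pmf_eq_1)
  have "\<tau>\<^sup>2 \<le> (1 / 2 * (\<Sum>x\<in>A. \<bar>q x - pmf p x\<bar>))\<^sup>2"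
    using tv assms(5) by (intro power_mono) auto
  also have "\<dots> \<le> 1 - \<rho>\<^sup>2"
    unfolding \<rho>_def using assms(3,4) sum1 by (intro tv_hellinger_affinity) auto
  finally have "\<rho>\<^sup>2 \<le> 1 - \<tau>\<^sup>2" by simp
  also have "\<dots> \<le> exp (- \<tau>\<^sup>2)" using exp_ge_add_one_self[of "- \<tau>\<^sup>2"] by simp
  also have "\<dots> = (exp (- \<tau>\<^sup>2 / 2))\<^sup>2" by (simp add: power2_eq_square exp_add[symmetric])
  finally have \<rho>le: "\<rho> \<le> exp (- \<tau>\<^sup>2 / 2)" by (rule power2_le_imp_le) simp
  have "measure_pmf.expectation p f = (\<Sum>x\<in>A. f x * pmf p x)"
    using assms(1,2) by (intro integral_measure_pmf_real) auto
  also have "\<dots> \<le> \<rho>" unfolding \<rho>_def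
  proof (rule sum_mono)
    fix x assume "x \<in> A"
    \<comment> \<open>Equality holds where \<open>pmf p x\<close> is nonzero. Elsewhere both sides
      vanish, so the totalized division in \<open>f\<close> does no harm.\<close>
    show "f x * pmf p x \<le> sqrt (pmf p x * q x)"
    proof (cases "pmf p x = 0")
      case False
      then have "f x * pmf p x = sqrt (q x / pmf p x) * sqrt ((pmf p x)\<^sup>2)" by (simp add: f_def)
      also have "\<dots> = sqrt (pmf p x * q x)"
        using False by (simp only: real_sqrt_mult[symmetric]) (simp add: power2_eq_square field_simps)
      finally show ?thesis by simp
    qed simp
  qed
  finally have Ef: "measure_pmf.expectation p f \<le> \<rho>" .
  have Ef0: "0 \<le> measure_pmf.expectation p f"
    using assms(2) f0 by (intro integral_nonneg_AE) (auto simp: AE_measure_pmf_iff)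
  have finP: "finite (set_pmf P)"
    unfolding P_def iid_pmf_def using fin by (subst set_Pi_pmf) (auto intro!: finite_PiE_dflt)
  have "measure_pmf.prob P {s. exp (- 1) * (\<Prod>i<n. pmf p (s i)) \<le> (\<Prod>i<n. q (s i))}
      \<le> measure_pmf.prob P {s \<in> space (measure_pmf P). exp (- 1 / 2) \<le> (\<Prod>i<n. f (s i))}"
  \<comment> \<open>The inclusion of events can fail off the support: there the product of the
    \<open>pmf p (s i)\<close> is 0 and the left event may hold trivially.\<close>
  proof (rule measure_pmf.finite_measure_mono_AE)
    show "AE s in measure_pmf P. s \<in> {s. exp (- 1) * (\<Prod>i<n. pmf p (s i)) \<le> (\<Prod>i<n. q (s i))}
       \<longrightarrow> s \<in> {s \<in> space (measure_pmf P). exp (- 1 / 2) \<le> (\<Prod>i<n. f (s i))}"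
    proof (clarsimp simp: AE_measure_pmf_iff)
      fix s assume s: "s \<in> set_pmf P"
        and le: "exp (- 1) * (\<Prod>i<n. pmf p (s i)) \<le> (\<Prod>i<n. q (s i))"
      have pos: "(\<Prod>i<n. pmf p (s i)) > 0"
        using setP[OF s] by (intro prod_pos) (auto intro: pmf_positive)
      \<comment> \<open>The slack \<open>exp (- 1)\<close> allowed to the rounded model becomes
        \<open>exp (- 1 / 2)\<close> under the root; dividing by it in Markov's inequality produces
        the \<open>1 / 2\<close> in the final exponent.\<close>
      have "exp (- 1 / 2) = sqrt (exp (- 1 :: real))"
        by (intro real_sqrt_unique[symmetric]) (auto simp: power2_eq_square exp_add[symmetric])
      also have "\<dots> \<le> sqrt ((\<Prod>i<n. q (s i)) / (\<Prod>i<n. pmf p (s i)))"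
        using le pos by (simp add: pos_le_divide_eq)
      also have "\<dots> = (\<Prod>i<n. f (s i))"
        by (simp add: f_def prod_dividef[symmetric] real_sqrt_prod)
      finally show "exp (- (1 / 2)) \<le> (\<Prod>i<n. f (s i))" by simp
    qed
  qed auto
  also have "\<dots> \<le> measure_pmf.expectation P (\<lambda>s. \<Prod>i<n. f (s i)) / exp (- 1 / 2)"
  proof (rule integral_Markov_inequality_measure)
    show "AE s in measure_pmf P. 0 \<le> (\<Prod>i<n. f (s i))"
      using setP assms(2) by (auto simp: AE_measure_pmf_iff intro!: prod_nonneg f0)
  qed (auto intro: integrable_measure_pmf_finite finP)
  also have "measure_pmf.expectation P (\<lambda>s. \<Prod>i<n. f (s i)) = measure_pmf.expectation p f ^ n"
    unfolding P_def iid_pmf_def using assms(2) f0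
    by (subst expectation_prod_Pi_pmf) (auto intro: integrable_measure_pmf_finite fin)
  also have "measure_pmf.expectation p f ^ n / exp (- 1 / 2) \<le> exp (- \<tau>\<^sup>2 / 2) ^ n / exp (- 1 / 2)"
    using Ef Ef0 \<rho>le by (intro divide_right_mono power_mono) auto
  also have "\<dots> = exp (1 / 2 - real n * \<tau>\<^sup>2 / 2)"
    by (simp add: exp_of_nat_mult[symmetric] exp_diff[symmetric] algebra_simps)
  finally show ?thesis by (simp add: P_def)
qed

text \<open>The hypothesis on \<open>\<tau>\<close> says exactly that the tail bound of one
  candidate is at most \<open>\<delta> / N\<close>, so that a union bound over at most
  \<open>N\<close> candidates costs \<open>\<delta>\<close>.\<close>

lemma likelihood_ratio_uniform:
  fixes p :: "'a pmf" and Q :: "('a \<Rightarrow> real) set"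
  assumes "finite A" "set_pmf p \<subseteq> A" and finQ: "finite Q"
    and q0: "\<And>q x. q \<in> Q \<Longrightarrow> x \<in> A \<Longrightarrow> 0 \<le> q x" and q1: "\<And>q. q \<in> Q \<Longrightarrow> (\<Sum>x\<in>A. q x) = 1"
    and N: "real (card Q) \<le> N" "0 < N" and n: "0 < n" and "0 < \<delta>" and "0 \<le> \<tau>"
    and \<tau>: "1 + 2 * ln N + 2 * ln (1 / \<delta>) \<le> real n * \<tau>\<^sup>2"
  shows "1 - \<delta> \<le> measure_pmf.prob (iid_pmf n p)
    {s. \<forall>q\<in>Q. exp (- 1) * (\<Prod>i<n. pmf p (s i)) \<le> (\<Prod>i<n. q (s i))
          \<longrightarrow> 1 / 2 * (\<Sum>x\<in>A. \<bar>q x - pmf p x\<bar>) \<le> \<tau>}"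
    (is "_ \<le> measure_pmf.prob ?P ?G")
proof -
  let ?E = "\<lambda>q. {s. exp (- 1) * (\<Prod>i<n. pmf p (s i)) \<le> (\<Prod>i<n. q (s i))
          \<and> \<tau> < 1 / 2 * (\<Sum>x\<in>A. \<bar>q x - pmf p x\<bar>)}"
  \<comment> \<open>A candidate within \<open>\<tau>\<close> of the truth has an empty bad event;
    only the distant ones need the tail bound.\<close>
  have each: "measure_pmf.prob ?P (?E q) \<le> \<delta> / N" if q: "q \<in> Q" for q
  proof (cases "\<tau> < 1 / 2 * (\<Sum>x\<in>A. \<bar>q x - pmf p x\<bar>)")
    case True
    have "measure_pmf.prob ?P (?E q) \<le> exp (1 / 2 - real n * \<tau>\<^sup>2 / 2)"
      using likelihood_ratio_tail[of A p q \<tau> n] True assms q by simp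
    also have "\<dots> \<le> exp (ln \<delta> - ln N)" using \<tau> \<open>0 < \<delta>\<close> by (simp add: ln_div)
    also have "\<dots> = \<delta> / N" using \<open>0 < \<delta>\<close> \<open>0 < N\<close> by (simp add: exp_diff)
    finally show ?thesis .
  qed (use N \<open>0 < \<delta>\<close> in auto)
  have "measure_pmf.prob ?P (- ?G) \<le> measure_pmf.prob ?P (\<Union>q\<in>Q. ?E q)"
    by (intro measure_pmf.finite_measure_mono) (auto simp: not_le)
  also have "\<dots> \<le> (\<Sum>q\<in>Q. measure_pmf.prob ?P (?E q))"
    using finQ by (intro measure_pmf.finite_measure_subadditive_finite) auto
  also have "\<dots> \<le> real (card Q) * (\<delta> / N)"
    using each by (intro sum_bounded_above)
  also have "\<dots> \<le> \<delta>" using N \<open>0 < \<delta>\<close> by (simp add: field_simps)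
  finally have "measure_pmf.prob ?P (- ?G) \<le> \<delta>" .
  moreover have "measure_pmf.prob ?P (- ?G) = 1 - measure_pmf.prob ?P ?G"
    using measure_pmf.prob_compl[of ?G ?P] by (simp add: Compl_eq_Diff_UNIV)
  ultimately show ?thesis by simp
qed

subsection \<open>Sensitivity to the parameters\<close>

text \<open>The difference is split as \<open>A (z' - z) + (A' - A) z'\<close>, plus the change of
  the bias. The generous \<open>Q\<close> absorbs the bias terms as well, so that size and error
  obey one recursion: \<open>X\<close> becomes \<open>Q * X\<close> and \<open>e\<close> becomes
  \<open>Q * (e + \<eta> * X)\<close>. The width enters through an upper bound \<open>R\<close>,
  which gives all layers the same \<open>Q\<close>.\<close>

lemma affine_layer_perturb:
  assumes A: "A \<in> carrier_mat m k" and A': "A' \<in> carrier_mat m k"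
    and b: "b \<in> carrier_vec m" and b': "b' \<in> carrier_vec m"
    and z: "z \<in> carrier_vec k" and z': "z' \<in> carrier_vec k" and i: "i < m" and k: "k \<le> R"
    and AB: "\<And>j. j < k \<Longrightarrow> \<bar>A $$ (i, j)\<bar> \<le> B" and bB: "\<bar>b $ i\<bar> \<le> B"
    and dA: "\<And>j. j < k \<Longrightarrow> \<bar>A' $$ (i, j) - A $$ (i, j)\<bar> \<le> \<eta>" and db: "\<bar>b' $ i - b $ i\<bar> \<le> \<eta>"
    and zX: "\<And>j. j < k \<Longrightarrow> \<bar>z $ j\<bar> \<le> X" and z'X: "\<And>j. j < k \<Longrightarrow> \<bar>z' $ j\<bar> \<le> X"
    and dz: "\<And>j. j < k \<Longrightarrow> \<bar>z' $ j - z $ j\<bar> \<le> e"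
    and pos: "0 \<le> B" "0 \<le> \<eta>" "1 \<le> X" "0 \<le> e"
  defines "Q \<equiv> (real R + 1) * (1 + B)"
  shows "\<bar>(A *\<^sub>v z + b) $ i\<bar> \<le> Q * X"
    and "\<bar>(A' *\<^sub>v z' + b') $ i - (A *\<^sub>v z + b) $ i\<bar> \<le> Q * (e + \<eta> * X)"
proof -
  have ex: "(A *\<^sub>v z + b) $ i = (\<Sum>j<k. A $$ (i, j) * z $ j) + b $ i"
    using A b z i by (simp add: scalar_prod_def lessThan_atLeast0)
  have ex': "(A' *\<^sub>v z' + b') $ i = (\<Sum>j<k. A' $$ (i, j) * z' $ j) + b' $ i"
    using A' b' z' i by (simp add: scalar_prod_def lessThan_atLeast0)
  have "\<bar>\<Sum>j<k. A $$ (i, j) * z $ j\<bar> \<le> (\<Sum>j<k. B * X)"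
    using AB zX pos by (intro order_trans[OF sum_abs] sum_mono) (auto simp: abs_mult intro!: mult_mono)
  also have "\<dots> \<le> R * (B * X)" using k pos by (simp add: mult_right_mono)
  finally have "\<bar>(A *\<^sub>v z + b) $ i\<bar> \<le> R * (B * X) + B" using bB unfolding ex by linarith
  also have "\<dots> \<le> Q * X"
  proof -
    have "B \<le> B * X" using pos by (simp add: mult_le_cancel_left1)
    moreover have "0 \<le> R * X" "0 \<le> X" using pos by auto
    moreover have "Q * X = R * (B * X) + B * X + R * X + X" by (simp add: Q_def algebra_simps)
    ultimately show ?thesis by linarith
  qed
  finally show "\<bar>(A *\<^sub>v z + b) $ i\<bar> \<le> Q * X" .
  have t: "\<bar>A' $$ (i, j) * z' $ j - A $$ (i, j) * z $ j\<bar> \<le> B * e + \<eta> * X" if j: "j < k" for j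
  proof -
    have "A' $$ (i, j) * z' $ j - A $$ (i, j) * z $ j
        = A $$ (i, j) * (z' $ j - z $ j) + (A' $$ (i, j) - A $$ (i, j)) * z' $ j"
      by (simp add: algebra_simps)
    also have "\<bar>\<dots>\<bar> \<le> \<bar>A $$ (i, j)\<bar> * \<bar>z' $ j - z $ j\<bar> + \<bar>A' $$ (i, j) - A $$ (i, j)\<bar> * \<bar>z' $ j\<bar>"
      by (metis abs_mult abs_triangle_ineq)
    also have "\<dots> \<le> B * e + \<eta> * X"
      using AB[OF j] dz[OF j] dA[OF j] z'X[OF j] pos by (intro add_mono mult_mono) auto
    finally show ?thesis .
  qed
  have "\<bar>(\<Sum>j<k. A' $$ (i, j) * z' $ j) - (\<Sum>j<k. A $$ (i, j) * z $ j)\<bar> \<le> (\<Sum>j<k. B * e + \<eta> * X)"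
    unfolding sum_subtractf[symmetric] by (intro order_trans[OF sum_abs] sum_mono) (auto simp: t)
  also have "\<dots> \<le> R * (B * e + \<eta> * X)" using k pos by (simp add: mult_right_mono)
  finally have "\<bar>(A' *\<^sub>v z' + b') $ i - (A *\<^sub>v z + b) $ i\<bar> \<le> R * (B * e + \<eta> * X) + \<eta>"
    using db unfolding ex ex' by linarith
  also have "\<dots> \<le> Q * (e + \<eta> * X)"
  proof -
    have "\<eta> \<le> \<eta> * X" using pos by (simp add: mult_le_cancel_left1)
    moreover have "0 \<le> R * e" "0 \<le> B * e" "0 \<le> R * (B * (\<eta> * X))" "0 \<le> B * (\<eta> * X)" using pos by auto
    moreover have "Q * (e + \<eta> * X) = R * (B * e + \<eta> * X) + \<eta> * X + R * e + R * (B * (\<eta> * X))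
        + B * e + B * (\<eta> * X) + e"
      by (simp add: Q_def algebra_simps)
    ultimately show ?thesis using pos(4) by linarith
  qed
  finally show "\<bar>(A' *\<^sub>v z' + b') $ i - (A *\<^sub>v z + b) $ i\<bar> \<le> Q * (e + \<eta> * X)" .
qed

text \<open>The box condition of \<open>mlp_class\<close> for a fixed width function, freed from the
  sparsity budget and from the fixed length. Removing the first layer merely shifts
  \<open>w\<close>, which makes induction over the layers possible.\<close>

definition layers_in :: "(nat \<Rightarrow> nat) \<Rightarrow> real \<Rightarrow> mlp_params \<Rightarrow> bool" where
  "layers_in w B \<omega> \<longleftrightarrow> (\<forall>l<length \<omega>. fst (\<omega> ! l) \<in> mat_box (w (Suc l)) (w l) (- B) B \<and>
     snd (\<omega> ! l) \<in> vec_box (w (Suc l)) (- B) B)"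

lemma layers_in_Cons:
  "layers_in w B ((A, b) # ls) \<longleftrightarrow> A \<in> mat_box (w 1) (w 0) (- B) B \<and> b \<in> vec_box (w 1) (- B) B
     \<and> layers_in (\<lambda>l. w (Suc l)) B ls"
  unfolding layers_in_def by (auto simp: less_Suc_eq_0_disj)

definition layer_dist_le :: "real \<Rightarrow> real mat \<times> real vec \<Rightarrow> real mat \<times> real vec \<Rightarrow> bool" where
  "layer_dist_le \<eta> = (\<lambda>(A, b) (A', b').
     (\<forall>i<dim_row A. \<forall>j<dim_col A. \<bar>A' $$ (i, j) - A $$ (i, j)\<bar> \<le> \<eta>) \<and>
     (\<forall>i<dim_vec b. \<bar>b' $ i - b $ i\<bar> \<le> \<eta>))"

text \<open>ReLU neither enlarges absolute values nor differences, so only the affine maps count.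
  The first layer passes \<open>Q * X\<close> and \<open>Q * (e + \<eta> * X)\<close> to the rest,
  and in the bound for the rest each layer adds the same amount \<open>\<eta> * X\<close> once a
  power of \<open>Q\<close> is factored out. Hence \<open>X\<close> and \<open>e\<close> must vary
  in the induction.\<close>

lemma fold_layers_perturb:
  assumes "list_all2 (layer_dist_le \<eta>) ls ls'" "layers_in w B ls" "layers_in w B ls'"
    and "\<And>l. l < length ls \<Longrightarrow> w l \<le> R"
    and "z \<in> carrier_vec (w 0)" "z' \<in> carrier_vec (w 0)"
    and "\<And>j. j < w 0 \<Longrightarrow> \<bar>z $ j\<bar> \<le> X" "\<And>j. j < w 0 \<Longrightarrow> \<bar>z' $ j\<bar> \<le> X"
    and "\<And>j. j < w 0 \<Longrightarrow> \<bar>z' $ j - z $ j\<bar> \<le> e"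
    and "0 \<le> B" "0 \<le> \<eta>" "1 \<le> X" "0 \<le> e"
    and Q: "Q = (real R + 1) * (1 + B)" and "i < w (length ls)"
  shows "\<bar>fold (\<lambda>(A', b') z. A' *\<^sub>v relu_vec z + b') ls' z' $ i
       - fold (\<lambda>(A', b') z. A' *\<^sub>v relu_vec z + b') ls z $ i\<bar>
     \<le> Q ^ length ls * (e + real (length ls) * \<eta> * X)"
  using assms(1-9,12,13,15)
proof (induction ls ls' arbitrary: w z z' e X rule: list_all2_induct)
  case Nil
  then show ?case by simp
next
  case (Cons l ls l' ls')
  obtain A b A' b' where l: "l = (A, b)" "l' = (A', b')" by fastforce
  have box: "A \<in> mat_box (w 1) (w 0) (- B) B" "b \<in> vec_box (w 1) (- B) B"
      "A' \<in> mat_box (w 1) (w 0) (- B) B" "b' \<in> vec_box (w 1) (- B) B"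
    and rest: "layers_in (\<lambda>l. w (Suc l)) B ls" "layers_in (\<lambda>l. w (Suc l)) B ls'"
    using Cons.prems(1,2) by (auto simp: l layers_in_Cons)
  then have car: "A \<in> carrier_mat (w 1) (w 0)" "b \<in> carrier_vec (w 1)"
      "A' \<in> carrier_mat (w 1) (w 0)" "b' \<in> carrier_vec (w 1)"
    by (auto simp: mat_box_def vec_box_def)
  have bd: "\<bar>A $$ (i, j)\<bar> \<le> B" "\<bar>b $ i\<bar> \<le> B" "\<bar>A' $$ (i, j)\<bar> \<le> B" "\<bar>b' $ i\<bar> \<le> B"
    if "i < w 1" "j < w 0" for i j
    using box that by (auto simp: mat_box_def vec_box_def abs_le_iff neg_le_iff_le minus_le_iff)
  have bd2: "\<bar>b $ i\<bar> \<le> B" "\<bar>b' $ i\<bar> \<le> B" if "i < w 1" for i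
    using box that by (auto simp: mat_box_def vec_box_def abs_le_iff neg_le_iff_le minus_le_iff)
  have df: "\<bar>A' $$ (i, j) - A $$ (i, j)\<bar> \<le> \<eta>" if "i < w 1" "j < w 0" for i j
    using Cons.hyps(1) that car by (auto simp: layer_dist_le_def l)
  have df2: "\<bar>b' $ i - b $ i\<bar> \<le> \<eta>" if "i < w 1" for i
    using Cons.hyps(1) that car by (auto simp: layer_dist_le_def l)
  have wR: "w 0 \<le> R" using Cons.prems(3)[of 0] by simp
  have rc: "relu_vec z \<in> carrier_vec (w 0)" "relu_vec z' \<in> carrier_vec (w 0)"
    using Cons.prems(4,5) by (auto simp: relu_vec_def)
  have r: "\<bar>relu_vec z $ j\<bar> \<le> X" "\<bar>relu_vec z' $ j\<bar> \<le> X" "\<bar>relu_vec z' $ j - relu_vec z $ j\<bar> \<le> e"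
    if "j < w 0" for j
    using Cons.prems(4,5) Cons.prems(6-8)[OF that] that by (auto simp: relu_vec_def max_def)
  have Q1: "1 \<le> Q"
  proof -
    have "1 * 1 \<le> (real R + 1) * (1 + B)" using assms(10) by (intro mult_mono) auto
    then show ?thesis by (simp add: Q)
  qed
  let ?y = "A *\<^sub>v relu_vec z + b" and ?y' = "A' *\<^sub>v relu_vec z' + b'"
  have yd: "\<bar>?y' $ j - ?y $ j\<bar> \<le> Q * (e + \<eta> * X)" if "j < w 1" for j
    unfolding Q
    by (rule affine_layer_perturb(2)[where k = "w 0" and m = "w 1"],
        use car rc that wR bd bd2 df df2 r Cons.prems(9,10) assms(10,11) in \<open>auto\<close>)
  \<comment> \<open>Only the size of one output is wanted here, so the perturbed layer is taken
    equal to the layer itself, with zero errors.\<close>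
  have ya: "\<bar>?y $ j\<bar> \<le> Q * X" if "j < w 1" for j
    unfolding Q
    by (rule affine_layer_perturb(1)[where k = "w 0" and m = "w 1" and A' = A and z' = "relu_vec z" and b' = b and \<eta> = 0 and e = 0],
        use car rc that wR bd bd2 df df2 r Cons.prems(9,10) assms(10,11) in \<open>auto\<close>)
  have yb: "\<bar>?y' $ j\<bar> \<le> Q * X" if "j < w 1" for j
    unfolding Q
    by (rule affine_layer_perturb(1)[where k = "w 0" and m = "w 1" and A' = A' and z' = "relu_vec z'" and b' = b' and \<eta> = 0 and e = 0],
        use car rc that wR bd bd2 df df2 r Cons.prems(9,10) assms(10,11) in \<open>auto\<close>)
  have yc: "?y \<in> carrier_vec (w 1)" "?y' \<in> carrier_vec (w 1)"
    using car(2,4) by (metis carrier_vec_dim_vec carrier_vecD index_add_vec(2))+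
  have "\<bar>fold (\<lambda>(A', b') z. A' *\<^sub>v relu_vec z + b') ls' ?y' $ i
       - fold (\<lambda>(A', b') z. A' *\<^sub>v relu_vec z + b') ls ?y $ i\<bar>
     \<le> Q ^ length ls * (Q * (e + \<eta> * X) + real (length ls) * \<eta> * (Q * X))"
  proof (rule Cons.IH[OF rest])
    show "1 \<le> Q * X" using Q1 Cons.prems(9) mult_mono[of 1 Q 1 X] by simp
    show "0 \<le> Q * (e + \<eta> * X)" using Q1 Cons.prems(9,10) assms(11) by simp
    show "\<And>l. l < length ls \<Longrightarrow> w (Suc l) \<le> R" using Cons.prems(3) by simp
    show "i < w (Suc (length ls))" using Cons.prems(11) by simp
    show "?y \<in> carrier_vec (w (Suc 0))" "?y' \<in> carrier_vec (w (Suc 0))" using yc by auto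
    show "\<And>j. j < w (Suc 0) \<Longrightarrow> \<bar>?y $ j\<bar> \<le> Q * X" using ya by auto
    show "\<And>j. j < w (Suc 0) \<Longrightarrow> \<bar>?y' $ j\<bar> \<le> Q * X" using yb by auto
    show "\<And>j. j < w (Suc 0) \<Longrightarrow> \<bar>?y' $ j - ?y $ j\<bar> \<le> Q * (e + \<eta> * X)" using yd by auto
  qed
  also have "\<dots> = Q ^ length (l # ls) * (e + real (length (l # ls)) * \<eta> * X)"
    by (simp add: algebra_simps)
  finally show ?case by (simp add: l)
qed

text \<open>The missing activation before the first layer makes it an exception. On nonnegative
  inputs ReLU is the identity, so it can be inserted there and all layers treated alike.\<close>

lemma mlp_eq_fold:
  assumes "\<omega> \<noteq> []" "\<And>i. i < dim_vec x \<Longrightarrow> 0 \<le> x $ i"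
  shows "mlp \<omega> x = fold (\<lambda>(A', b') z. A' *\<^sub>v relu_vec z + b') \<omega> x"
proof -
  have "relu_vec x = x" using assms(2) by (intro eq_vecI) (auto simp: relu_vec_def)
  then show ?thesis using assms(1) by (cases \<omega>) auto
qed

lemma sigmoid_lipschitz: "\<bar>sigmoid a - sigmoid b\<bar> \<le> \<bar>a - b\<bar>"
proof -
  have *: "\<bar>sigmoid a - sigmoid b\<bar> \<le> \<bar>a - b\<bar>" if "b \<le> a" for a b
  proof -
    define u v where "u = exp (- a)" and "v = exp (- b)"
    have uv: "0 < u" "u \<le> v" using that by (auto simp: u_def v_def)
    have pos: "0 < 1 + u" "0 < 1 + v" using uv by auto
    have "sigmoid a - sigmoid b = (v - u) / ((1 + u) * (1 + v))"
      using pos by (simp add: sigmoid_def u_def[symmetric] v_def[symmetric] divide_simps)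
    \<comment> \<open>A Lipschitz constant 1 is enough, so the denominator may be lowered to
      \<open>v\<close>; what remains is \<open>1 - exp (- (a - b))\<close>.\<close>
    moreover have "(v - u) / ((1 + u) * (1 + v)) \<le> (v - u) / v"
    proof (rule divide_left_mono)
      show "v \<le> (1 + u) * (1 + v)" using uv by (simp add: algebra_simps)
    qed (use uv pos in \<open>auto intro!: mult_pos_pos\<close>)
    moreover have "(v - u) / v = 1 - exp (- (a - b))"
      using uv by (simp add: diff_divide_distrib u_def v_def exp_diff[symmetric])
    moreover have "1 - exp (- (a - b)) \<le> a - b" using exp_ge_add_one_self[of "- (a - b)"] by linarith
    moreover have "0 \<le> (v - u) / ((1 + u) * (1 + v))" using uv pos by simp
    ultimately show ?thesis using that by linarith
  qed
  show ?thesis using *[of a b] *[of b a] by (cases "b \<le> a") (auto simp: abs_minus_commute)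
qed

lemma sigmoid_bounds: "0 \<le> sigmoid t" "sigmoid t \<le> 1"
  unfolding sigmoid_def by (auto simp: add_pos_pos divide_le_eq_1)

text \<open>The numerator and the normalizing sum each change by a factor of at most
  \<open>exp e\<close>, which explains the \<open>2\<close>. The multiplicative form stays
  meaningful for arbitrarily small probabilities.\<close>

lemma softmax_perturb:
  assumes "dim_vec z = M" "dim_vec z' = M" "i < M"
    and d: "\<And>j. j < M \<Longrightarrow> \<bar>z' $ j - z $ j\<bar> \<le> e"
  shows "softmax z $ i \<le> exp (2 * e) * softmax z' $ i"
proof -
  have le: "exp (z $ j) \<le> exp e * exp (z' $ j)" "exp (z' $ j) \<le> exp e * exp (z $ j)" if "j < M" for j
    using d[OF that] by (auto simp: exp_add[symmetric])
  have pos: "0 < (\<Sum>j<M. exp (z $ j))" "0 < (\<Sum>j<M. exp (z' $ j))"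
    using assms(3) by (auto intro!: sum_pos)
  have "(\<Sum>j<M. exp (z' $ j)) \<le> exp e * (\<Sum>j<M. exp (z $ j))"
    unfolding sum_distrib_left using le by (intro sum_mono) auto
  then have "exp (z $ i) * (\<Sum>j<M. exp (z' $ j))
      \<le> (exp e * exp (z' $ i)) * (exp e * (\<Sum>j<M. exp (z $ j)))"
    using le(1)[OF assms(3)] pos by (intro mult_mono) auto
  also have "\<dots> = exp (2 * e) * exp (z' $ i) * (\<Sum>j<M. exp (z $ j))"
    by (simp add: mult_exp_exp mult.assoc mult.left_commute)
  finally show ?thesis using pos assms(1-3) by (simp add: softmax_def field_simps)
qed

subsection \<open>Rounding the parameters\<close>

definition grid_round :: "real \<Rightarrow> real \<Rightarrow> real" where
  "grid_round \<eta> t = sgn t * (\<eta> * of_int \<lfloor>\<bar>t\<bar> / \<eta>\<rfloor>)"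

lemma grid_round_bounds:
  assumes "0 < \<eta>"
  shows "\<bar>grid_round \<eta> t\<bar> \<le> \<bar>t\<bar>" "\<bar>grid_round \<eta> t - t\<bar> \<le> \<eta>" "0 \<le> t \<Longrightarrow> 0 \<le> grid_round \<eta> t"
    "t \<le> 0 \<Longrightarrow> grid_round \<eta> t \<le> 0"
proof -
  define u where "u = \<eta> * of_int \<lfloor>\<bar>t\<bar> / \<eta>\<rfloor>"
  have "of_int \<lfloor>\<bar>t\<bar> / \<eta>\<rfloor> \<le> \<bar>t\<bar> / \<eta>" by simp
  from pos_le_divide_eq[THEN iffD1, OF assms this] have u1: "u \<le> \<bar>t\<bar>"
    by (simp add: u_def mult.commute)
  have "\<bar>t\<bar> / \<eta> \<le> of_int \<lfloor>\<bar>t\<bar> / \<eta>\<rfloor> + 1" by linarith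
  then have u2: "\<bar>t\<bar> \<le> u + \<eta>" using assms by (simp add: u_def field_simps)
  have u0: "0 \<le> u" using assms by (simp add: u_def)
  have r: "grid_round \<eta> t = sgn t * u" by (simp add: grid_round_def u_def)
  show "\<bar>grid_round \<eta> t\<bar> \<le> \<bar>t\<bar>" "\<bar>grid_round \<eta> t - t\<bar> \<le> \<eta>" "0 \<le> t \<Longrightarrow> 0 \<le> grid_round \<eta> t"
    "t \<le> 0 \<Longrightarrow> grid_round \<eta> t \<le> 0"
    unfolding r using u0 u1 u2 assms by (auto simp: sgn_if)
qed

lemma grid_round_in_interval:
  assumes "0 < \<eta>" "lo \<le> 0" "0 \<le> hi" "t \<in> {lo..hi}"
  shows "grid_round \<eta> t \<in> {lo..hi}"
  using grid_round_bounds[OF assms(1), of t] assms by (cases "0 \<le> t") auto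

lemma grid_round_0 [simp]: "grid_round \<eta> 0 = 0"
  by (simp add: grid_round_def)

definition grid :: "real \<Rightarrow> real \<Rightarrow> real set" where
  "grid \<eta> b = (\<lambda>k. \<eta> * of_int k) ` {- \<lfloor>b / \<eta>\<rfloor>..\<lfloor>b / \<eta>\<rfloor>}"

lemma grid_round_in_grid:
  assumes "0 < \<eta>" "\<bar>t\<bar> \<le> b"
  shows "grid_round \<eta> t \<in> grid \<eta> b"
proof -
  define K N where "K = \<lfloor>\<bar>t\<bar> / \<eta>\<rfloor>" and "N = \<lfloor>b / \<eta>\<rfloor>"
  have m: "K \<le> N" "0 \<le> K"
    unfolding K_def N_def using assms by (auto intro!: floor_mono divide_right_mono)
  have "grid_round \<eta> t \<in> (\<lambda>k. \<eta> * of_int k) ` {- N..N}"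
  proof (cases "0 \<le> t")
    case True
    then have "grid_round \<eta> t = \<eta> * of_int K" by (auto simp: grid_round_def sgn_if K_def)
    then show ?thesis using m by (intro image_eqI[where x = K]) auto
  next
    case False
    then have "grid_round \<eta> t = \<eta> * of_int (- K)" by (auto simp: grid_round_def sgn_if K_def)
    then show ?thesis using m by (intro image_eqI[where x = "- K"]) auto
  qed
  then show ?thesis by (simp only: grid_def N_def)
qed

lemma finite_grid: "finite (grid \<eta> b)"
  by (simp add: grid_def)

lemma zero_in_grid: "0 < \<eta> \<Longrightarrow> 0 \<le> b \<Longrightarrow> 0 \<in> grid \<eta> b"
  using grid_round_in_grid[of \<eta> 0 b] by simp

lemma card_grid:
  assumes "0 < \<eta>" "0 \<le> b"
  shows "real (card (grid \<eta> b)) \<le> 2 * b / \<eta> + 1"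
proof -
  have "card (grid \<eta> b) \<le> card {- \<lfloor>b / \<eta>\<rfloor>..\<lfloor>b / \<eta>\<rfloor>}"
    unfolding grid_def by (rule card_image_le) simp
  also have "\<dots> = nat (2 * \<lfloor>b / \<eta>\<rfloor> + 1)" by simp
  finally have "real (card (grid \<eta> b)) \<le> real (nat (2 * \<lfloor>b / \<eta>\<rfloor> + 1))" by simp
  also have "\<dots> = 2 * of_int \<lfloor>b / \<eta>\<rfloor> + 1" using assms by simp
  also have "\<dots> \<le> 2 * (b / \<eta>) + 1" using of_int_floor_le[of "b / \<eta>"] by linarith
  finally show ?thesis by simp
qed

abbreviation "round_mat \<eta> \<equiv> map_mat (grid_round \<eta>)"
abbreviation "round_vec \<eta> \<equiv> map_vec (grid_round \<eta>)"
abbreviation "round_mlp \<eta> \<equiv> map (map_prod (round_mat \<eta>) (round_vec \<eta>))"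

definition round_params :: "real \<Rightarrow> ar_params \<Rightarrow> ar_params" where
  "round_params \<eta> = map_prod (round_mat \<eta>) (map_prod (round_mat \<eta>) (map_prod (round_vec \<eta>) (round_mlp \<eta>)))"

lemma round_mat_box:
  assumes "0 < \<eta>" "lo \<le> 0" "0 \<le> hi" "A \<in> mat_box m n lo hi"
  shows "round_mat \<eta> A \<in> mat_box m n lo hi"
  using assms(4) grid_round_in_interval[OF assms(1-3)] unfolding mat_box_def by auto

lemma round_vec_box:
  assumes "0 < \<eta>" "lo \<le> 0" "0 \<le> hi" "v \<in> vec_box n lo hi"
  shows "round_vec \<eta> v \<in> vec_box n lo hi"
  using assms(4) grid_round_in_interval[OF assms(1-3)] unfolding vec_box_def by auto

lemma nnz_round_mat: "nnz_mat (round_mat \<eta> A) \<le> nnz_mat A"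
  unfolding nnz_mat_def
proof (rule card_mono)
  show "finite {(i, j). i < dim_row A \<and> j < dim_col A \<and> A $$ (i, j) \<noteq> 0}"
    by (rule finite_subset[of _ "{..<dim_row A} \<times> {..<dim_col A}"]) auto
qed auto

lemma nnz_round_vec: "nnz_vec (round_vec \<eta> v) \<le> nnz_vec v"
  unfolding nnz_vec_def by (rule card_mono) auto

lemma layers_in_round:
  assumes "0 < \<eta>" "0 \<le> B" "layers_in w B \<omega>"
  shows "layers_in w B (round_mlp \<eta> \<omega>)"
  using assms unfolding layers_in_def by (auto intro!: round_mat_box round_vec_box)

lemma mlp_class_iff:
  "\<omega> \<in> mlp_class d_in d_out L W S B \<longleftrightarrow> length \<omega> = L \<and>
     (\<exists>w. w 0 = d_in \<and> w L = d_out \<and> (\<forall>l\<in>{1..L}. 1 \<le> w l \<and> w l \<le> W) \<and> layers_in w B \<omega>) \<and>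
     (\<Sum>(A, b)\<leftarrow>\<omega>. nnz_mat A + nnz_vec b) \<le> S"
  unfolding mlp_class_def layers_in_def by auto

lemma round_mlp_class:
  assumes "0 < \<eta>" "0 \<le> B" "\<omega> \<in> mlp_class d_in d_out L W S B"
  shows "round_mlp \<eta> \<omega> \<in> mlp_class d_in d_out L W S B"
proof -
  have "(\<Sum>(A, b)\<leftarrow>round_mlp \<eta> \<omega>. nnz_mat A + nnz_vec b) \<le> (\<Sum>(A, b)\<leftarrow>\<omega>. nnz_mat A + nnz_vec b)"
    by (simp add: o_def case_prod_unfold) (intro sum_list_mono add_mono nnz_round_mat nnz_round_vec)
  then show ?thesis
    using assms(3) layers_in_round[OF assms(1,2)] unfolding mlp_class_iff by fastforce
qed

lemma round_params_Psi:
  assumes "0 < \<eta>" "0 \<le> B" "\<psi> \<in> Psi_set D M de L W S B"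
  shows "round_params \<eta> \<psi> \<in> Psi_set D M de L W S B"
  using assms unfolding Psi_set_def round_params_def
  by (auto intro!: round_mat_box round_vec_box round_mlp_class)

section \<open>Effect of rounding on the model probabilities\<close>

lemma round_mlp_perturb:
  assumes \<eta>: "0 < \<eta>" and B: "0 \<le> B" and \<omega>: "\<omega> \<in> mlp_class d_in d_out L W S B" and L: "1 \<le> L"
    and x: "x \<in> vec_box d_in 0 1" and x': "x' \<in> vec_box d_in 0 1"
    and e: "\<And>j. j < d_in \<Longrightarrow> \<bar>x' $ j - x $ j\<bar> \<le> e" "0 \<le> e" and i: "i < d_out"
  shows "\<bar>mlp (round_mlp \<eta> \<omega>) x' $ i - mlp \<omega> x $ i\<bar>
    \<le> ((real (W + d_in) + 1) * (1 + B)) ^ L * (e + real L * \<eta>)"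
proof -
  obtain w where w: "w 0 = d_in" "w L = d_out" "\<And>l. l \<in> {1..L} \<Longrightarrow> w l \<le> W"
      and lay: "layers_in w B \<omega>" and len: "length \<omega> = L"
    using \<omega> unfolding mlp_class_iff by auto
  have xs: "x \<in> carrier_vec d_in" "x' \<in> carrier_vec d_in"
      "\<And>j. j < d_in \<Longrightarrow> \<bar>x $ j\<bar> \<le> 1" "\<And>j. j < d_in \<Longrightarrow> \<bar>x' $ j\<bar> \<le> 1"
    using x x' by (auto simp: vec_box_def)
  have ne: "\<omega> \<noteq> []" "round_mlp \<eta> \<omega> \<noteq> []" using len L by auto
  have "list_all2 (layer_dist_le \<eta>) \<omega> (round_mlp \<eta> \<omega>)"
    using grid_round_bounds(2)[OF \<eta>]
    by (auto simp: list_all2_conv_all_nth layer_dist_le_def case_prod_unfold)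
  moreover have "layers_in w B (round_mlp \<eta> \<omega>)" using layers_in_round \<eta> B lay by auto
  \<comment> \<open>\<open>W\<close> bounds the output widths of the layers but not
    \<open>d_in\<close>, the input width of the first one; the sum bounds both.\<close>
  moreover have "w l \<le> W + d_in" if "l < length \<omega>" for l
    using w(1) w(3)[of l] that len by (cases l) auto
  ultimately have "\<bar>fold (\<lambda>(A', b') z. A' *\<^sub>v relu_vec z + b') (round_mlp \<eta> \<omega>) x' $ i
       - fold (\<lambda>(A', b') z. A' *\<^sub>v relu_vec z + b') \<omega> x $ i\<bar>
     \<le> ((real (W + d_in) + 1) * (1 + B)) ^ length \<omega> * (e + real (length \<omega>) * \<eta> * 1)"
    using xs e w(1,2) len i \<eta> B
    by (intro fold_layers_perturb[where w = w and B = B and R = "W + d_in", OF _ lay]) simp_all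
  moreover have "mlp \<omega> x = fold (\<lambda>(A', b') z. A' *\<^sub>v relu_vec z + b') \<omega> x"
    using x by (intro mlp_eq_fold ne) (auto simp: vec_box_def)
  moreover have "mlp (round_mlp \<eta> \<omega>) x' = fold (\<lambda>(A', b') z. A' *\<^sub>v relu_vec z + b') (round_mlp \<eta> \<omega>) x'"
    using x' by (intro mlp_eq_fold ne) (auto simp: vec_box_def)
  ultimately show ?thesis using len by simp
qed

lemma token_index_less:
  assumes "x \<in> token_seqs D M" "j < D"
  shows "x ! j - 1 < M"
proof -
  have "x ! j \<in> set x" "set x \<subseteq> {1..M}" using assms by (auto simp: token_seqs_def)
  then have "x ! j \<in> {1..M}" by blast
  then show ?thesis by auto
qed

text \<open>Before the sigmoid, entry \<open>j\<close> is entry \<open>j\<close> of the affine map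
  \<open>A0\<close>, \<open>b0\<close> applied to row \<open>j\<close> of the embedding matrix, so
  the estimate for one layer applies. The factor 2 collects the rounding of the embedding row and
  that of \<open>A0\<close> and \<open>b0\<close>; the sigmoid does not enlarge the error.\<close>

lemma hidden_vec_perturb:
  assumes \<eta>: "0 < \<eta>" and B: "0 \<le> B" and \<phi>: "\<phi> \<in> Phi_set de" and \<psi>: "\<psi> \<in> Psi_set D M de L W S B"
    and x: "x \<in> token_seqs D M" and j: "j < D"
  shows "\<bar>hidden_vec D de (round_vec \<eta> \<phi>) (round_params \<eta> \<psi>) x $ j - hidden_vec D de \<phi> \<psi> x $ j\<bar>
    \<le> 2 * (real de + 1) * (1 + B) * \<eta>"
proof -
  obtain V A0 b0 \<omega> where \<psi>_eq: "\<psi> = (V, A0, b0, \<omega>)" by (metis prod_cases4)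
  have V: "V \<in> mat_box M de 0 1" and A: "A0 \<in> mat_box D de (- B) B" and b: "b0 \<in> vec_box D (- B) B"
    using \<psi> by (auto simp: \<psi>_eq Psi_set_def)
  have tok: "x ! (j - 1) - 1 < M" using j by (intro token_index_less[OF x]) auto
  have dims: "dim_row A0 = D" "dim_vec b0 = D"
    using A b by (auto simp: mat_box_def vec_box_def)
  define z z' where "z = row (embedding D de \<phi> V x) j"
    and "z' = row (embedding D de (round_vec \<eta> \<phi>) (round_mat \<eta> V) x) j"
  have zc: "z \<in> carrier_vec de" "z' \<in> carrier_vec de"
    by (auto simp: embedding_def z_def z'_def intro!: carrier_vecI)
  have z: "z $ c = (if j = 0 then \<phi> $ c else V $$ (x ! (j - 1) - 1, c))"
    "z' $ c = grid_round \<eta> (z $ c)" "\<bar>z $ c\<bar> \<le> 1" if c: "c < de" for c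
  proof -
    show z: "z $ c = (if j = 0 then \<phi> $ c else V $$ (x ! (j - 1) - 1, c))"
      using j c by (simp add: z_def embedding_def)
    have "z' $ c = (if j = 0 then round_vec \<eta> \<phi> $ c else round_mat \<eta> V $$ (x ! (j - 1) - 1, c))"
      using j c by (simp add: z'_def embedding_def)
    then show "z' $ c = grid_round \<eta> (z $ c)"
      using z \<phi> V tok c by (auto simp: Phi_set_def vec_box_def mat_box_def)
    show "\<bar>z $ c\<bar> \<le> 1"
      unfolding z using \<phi> V tok c by (auto simp: Phi_set_def vec_box_def mat_box_def)
  qed
  have bound: "\<bar>(round_mat \<eta> A0 *\<^sub>v z' + round_vec \<eta> b0) $ j - (A0 *\<^sub>v z + b0) $ j\<bar>
      \<le> ((real de + 1) * (1 + B)) * (\<eta> + \<eta> * 1)"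
  proof (rule affine_layer_perturb(2)[where m = D and k = de])
    show "\<bar>z' $ c\<bar> \<le> 1" if "c < de" for c
      using z[OF that] grid_round_bounds(1)[OF \<eta>] order_trans by metis
    show "\<bar>z' $ c - z $ c\<bar> \<le> \<eta>" if "c < de" for c
      using z[OF that] grid_round_bounds(2)[OF \<eta>] by metis
    show "\<bar>A0 $$ (j, c)\<bar> \<le> B" if "c < de" for c
      using A j that by (auto simp: mat_box_def abs_le_iff minus_le_iff)
    show "\<bar>b0 $ j\<bar> \<le> B" using b j by (auto simp: vec_box_def abs_le_iff minus_le_iff)
    show "\<bar>round_mat \<eta> A0 $$ (j, c) - A0 $$ (j, c)\<bar> \<le> \<eta>" if "c < de" for c
      using A j that grid_round_bounds(2)[OF \<eta>] by (auto simp: mat_box_def)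
    show "\<bar>round_vec \<eta> b0 $ j - b0 $ j\<bar> \<le> \<eta>"
      using b j grid_round_bounds(2)[OF \<eta>] by (auto simp: vec_box_def)
    show "A0 \<in> carrier_mat D de" "round_mat \<eta> A0 \<in> carrier_mat D de"
        "b0 \<in> carrier_vec D" "round_vec \<eta> b0 \<in> carrier_vec D"
      using A b by (auto simp: mat_box_def vec_box_def)
  qed (use zc z(3) j \<eta> B in auto)
  have "hidden_vec D de \<phi> \<psi> x $ j = sigmoid ((A0 *\<^sub>v z + b0) $ j)"
    using dims j by (simp add: hidden_vec_def \<psi>_eq z_def)
  moreover have "hidden_vec D de (round_vec \<eta> \<phi>) (round_params \<eta> \<psi>) x $ j
      = sigmoid ((round_mat \<eta> A0 *\<^sub>v z' + round_vec \<eta> b0) $ j)"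
    using dims j by (simp add: hidden_vec_def \<psi>_eq z'_def round_params_def)
  ultimately have "\<bar>hidden_vec D de (round_vec \<eta> \<phi>) (round_params \<eta> \<psi>) x $ j - hidden_vec D de \<phi> \<psi> x $ j\<bar>
      \<le> \<bar>(round_mat \<eta> A0 *\<^sub>v z' + round_vec \<eta> b0) $ j - (A0 *\<^sub>v z + b0) $ j\<bar>"
    by (simp only: sigmoid_lipschitz)
  also note bound
  finally show ?thesis by (simp add: algebra_simps)
qed

text \<open>Bound on the change of the logarithm of a sequence probability: \<open>D\<close> tokens,
  a factor 2 from each softmax, and the logit error that results from the hidden vector and the
  \<open>L\<close> rounded layers. It is linear in \<open>\<eta>\<close>, so a prescribed error can
  be met exactly.\<close>

definition log_prob_error :: "nat \<Rightarrow> nat \<Rightarrow> nat \<Rightarrow> nat \<Rightarrow> real \<Rightarrow> real \<Rightarrow> real" where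
  "log_prob_error D de L W B \<eta> = 2 * real D * (((real (W + D) + 1) * (1 + B)) ^ L
      * (2 * (real de + 1) * (1 + B) * \<eta> + real L * \<eta>))"

text \<open>Each token contributes a factor \<open>exp (2 * E)\<close> and there are
  \<open>D\<close> of them. The first direction limits the loss of likelihood under rounding; the
  two together bound the total variation distance of a model from its rounding.\<close>

lemma ar_prob_round:
  assumes \<eta>: "0 < \<eta>" and B: "0 \<le> B" and \<phi>: "\<phi> \<in> Phi_set de" and \<psi>: "\<psi> \<in> Psi_set D M de L W S B"
    and x: "x \<in> token_seqs D M" and L: "1 \<le> L"
  defines "t \<equiv> log_prob_error D de L W B \<eta>"
  shows "ar_prob D de \<phi> \<psi> x \<le> exp t * ar_prob D de (round_vec \<eta> \<phi>) (round_params \<eta> \<psi>) x"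
    and "ar_prob D de (round_vec \<eta> \<phi>) (round_params \<eta> \<psi>) x \<le> exp t * ar_prob D de \<phi> \<psi> x"
proof -
  obtain V A0 b0 \<omega> where \<psi>_eq: "\<psi> = (V, A0, b0, \<omega>)" by (metis prod_cases4)
  define \<phi>' \<psi>' where "\<phi>' = round_vec \<eta> \<phi>" and "\<psi>' = round_params \<eta> \<psi>"
  define e where "e = 2 * (real de + 1) * (1 + B) * \<eta>"
  define E where "E = ((real (W + D) + 1) * (1 + B)) ^ L * (e + real L * \<eta>)"
  have e0: "0 \<le> e" using \<eta> B by (simp add: e_def)
  have \<omega>: "\<omega> \<in> mlp_class D M L W S B" using \<psi> by (auto simp: \<psi>_eq Psi_set_def)
  define g where "g d = mlp \<omega> (mask_after d (hidden_vec D de \<phi> \<psi> x))" for d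
  define g' where "g' d = mlp (round_mlp \<eta> \<omega>) (mask_after d (hidden_vec D de \<phi>' \<psi>' x))" for d
  have dimh: "dim_vec (hidden_vec D de \<phi> \<psi> x) = D" "dim_vec (hidden_vec D de \<phi>' \<psi>' x) = D"
    by (auto simp: hidden_vec_def case_prod_unfold)
  \<comment> \<open>Sigmoid values and masking zeros lie in the unit interval whatever the
    parameters are, so every network input has size at most 1.\<close>
  have box: "mask_after d (hidden_vec D de \<phi> \<psi> x) \<in> vec_box D 0 1" for d \<phi> \<psi>
    by (auto simp: mask_after_def hidden_vec_def case_prod_unfold vec_box_def sigmoid_bounds
        intro!: carrier_vecI)
  have gd: "\<bar>g' d $ i - g d $ i\<bar> \<le> E" if "i < M" for d i
    unfolding g_def g'_def E_def
  proof (rule round_mlp_perturb[OF \<eta> B \<omega> L box box])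
    \<comment> \<open>Masked entries are 0 in both models, so masking can only remove error.\<close>
    show "\<bar>mask_after d (hidden_vec D de \<phi>' \<psi>' x) $ j - mask_after d (hidden_vec D de \<phi> \<psi> x) $ j\<bar> \<le> e"
      if "j < D" for j
      using hidden_vec_perturb[OF \<eta> B \<phi> \<psi> x that] e0 that dimh
      by (simp add: mask_after_def e_def \<phi>'_def \<psi>'_def)
  qed (use that e0 in auto)
  have dims: "dim_vec (g d) = M" "dim_vec (g' d) = M" for d
    unfolding g_def g'_def using dim_mlp[OF \<omega> L] dim_mlp[OF round_mlp_class[OF \<eta> B \<omega>] L] by auto
  have tok: "x ! (d - 1) - 1 < M" if "d \<in> {1..D}" for d
    using that by (intro token_index_less[OF x]) auto
  have p: "ar_prob D de \<phi> \<psi> x = (\<Prod>d\<in>{1..D}. softmax (g d) $ (x ! (d - 1) - 1))"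
    by (simp add: ar_prob_def next_token_def \<psi>_eq g_def)
  have p': "ar_prob D de \<phi>' \<psi>' x = (\<Prod>d\<in>{1..D}. softmax (g' d) $ (x ! (d - 1) - 1))"
    by (simp add: ar_prob_def next_token_def \<psi>_eq \<psi>'_def g'_def round_params_def)
  have sm0: "0 \<le> softmax z $ i" if "i < dim_vec z" for z i
    using that by (auto simp: softmax_def intro!: divide_nonneg_nonneg sum_nonneg)
  have t: "exp t = exp (2 * E) ^ D"
    by (simp add: t_def log_prob_error_def E_def e_def exp_of_nat_mult[symmetric] algebra_simps)
  have c: "(\<Prod>d\<in>{1..D}. exp (2 * E) * f d) = exp t * (\<Prod>d\<in>{1..D}. f d)" for f :: "nat \<Rightarrow> real"
    by (simp add: prod.distrib t)
  show "ar_prob D de \<phi> \<psi> x \<le> exp t * ar_prob D de (round_vec \<eta> \<phi>) (round_params \<eta> \<psi>) x"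
    unfolding \<phi>'_def[symmetric] \<psi>'_def[symmetric] p p' c[symmetric]
    using gd dims tok by (intro prod_mono conjI sm0 softmax_perturb[where M = M]) auto
  show "ar_prob D de (round_vec \<eta> \<phi>) (round_params \<eta> \<psi>) x \<le> exp t * ar_prob D de \<phi> \<psi> x"
    unfolding \<phi>'_def[symmetric] \<psi>'_def[symmetric] p p' c[symmetric]
    using gd dims tok by (intro prod_mono conjI sm0 softmax_perturb[where M = M]) (auto simp: abs_minus_commute)
qed

subsection \<open>Counting the rounded parameters\<close>

lemma card_vec_entries:
  assumes "finite G" "X \<subseteq> {v \<in> carrier_vec n. \<forall>i<n. v $ i \<in> G}"
  shows "finite X" "card X \<le> card G ^ n"
proof -
  let ?F = "{..<n} \<rightarrow>\<^sub>E G"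
  have fin: "finite ?F" using assms(1) by (intro finite_PiE) auto
  have sub: "X \<subseteq> Matrix.vec n ` ?F"
  proof
    fix v assume "v \<in> X"
    with assms(2) have v: "v \<in> carrier_vec n" "\<And>i. i < n \<Longrightarrow> v $ i \<in> G" by auto
    have "v = Matrix.vec n (restrict (\<lambda>i. v $ i) {..<n})" using v by (intro eq_vecI) auto
    moreover have "restrict (\<lambda>i. v $ i) {..<n} \<in> ?F" using v by auto
    ultimately show "v \<in> Matrix.vec n ` ?F" by blast
  qed
  show "finite X" using sub fin finite_surj by blast
  have "card X \<le> card ?F" using sub fin surj_card_le by blast
  then show "card X \<le> card G ^ n" by (simp add: card_PiE)
qed

lemma card_mat_entries:
  assumes "finite G" "X \<subseteq> {A \<in> carrier_mat m n. \<forall>i<m. \<forall>j<n. A $$ (i, j) \<in> G}"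
  shows "finite X" "card X \<le> card G ^ (m * n)"
proof -
  let ?F = "{..<m} \<times> {..<n} \<rightarrow>\<^sub>E G"
  have fin: "finite ?F" using assms(1) by (intro finite_PiE) auto
  have sub: "X \<subseteq> Matrix.mat m n ` ?F"
  proof
    fix A assume "A \<in> X"
    with assms(2) have A: "A \<in> carrier_mat m n" "\<And>i j. i < m \<Longrightarrow> j < n \<Longrightarrow> A $$ (i, j) \<in> G" by auto
    have "A = Matrix.mat m n (restrict (\<lambda>ij. A $$ ij) ({..<m} \<times> {..<n}))" using A by (intro eq_matI) auto
    moreover have "restrict (\<lambda>ij. A $$ ij) ({..<m} \<times> {..<n}) \<in> ?F" using A by auto
    ultimately show "A \<in> Matrix.mat m n ` ?F" by blast
  qed
  show "finite X" using sub fin finite_surj by blast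
  have "card X \<le> card ?F" using sub fin surj_card_le by blast
  then show "card X \<le> card G ^ (m * n)" by (simp add: card_PiE card_cartesian_product)
qed

text \<open>A function with at most \<open>S\<close> nonzero values is recovered from a list of
  exactly \<open>S\<close> pairs of position and value, read as an association list with default 0.
  Counting lists of fixed length avoids binomial coefficients and sums over support sizes.\<close>

lemma card_sparse_functions:
  fixes P :: "'p set" and G :: "'v :: zero set" and S :: nat
  assumes P: "finite P" "P \<noteq> {}" and G: "finite G"
  defines "F \<equiv> {f. {p. f p \<noteq> 0} \<subseteq> P \<and> card {p. f p \<noteq> 0} \<le> S \<and> f ` P \<subseteq> G}"
  shows "finite F" "card F \<le> (card P * card G) ^ S"
proof -
  let ?X = "{xs. set xs \<subseteq> P \<times> G \<and> length xs = S}"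
  let ?dec = "\<lambda>xs p. case map_of xs p of Some v \<Rightarrow> v | None \<Rightarrow> 0"
  obtain p0 where p0: "p0 \<in> P" using P(2) by blast
  have fin: "finite ?X" using P(1) G by (intro finite_lists_length_eq) auto
  have sub: "F \<subseteq> ?dec ` ?X"
  proof
    fix f assume "f \<in> F"
    then have f: "{p. f p \<noteq> 0} \<subseteq> P" "card {p. f p \<noteq> 0} \<le> S" "f ` P \<subseteq> G" by (auto simp: F_def)
    obtain ps where ps: "set ps = {p. f p \<noteq> 0}" "distinct ps"
      using finite_distinct_list finite_subset[OF f(1) P(1)] by blast
    \<comment> \<open>Padding brings the list to length \<open>S\<close>. The added pairs carry the
      true value \<open>f p0\<close>, so they are harmless even if \<open>p0\<close> occurs already
      or \<open>f p0\<close> is 0.\<close>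
    define qs where "qs = ps @ replicate (S - length ps) p0"
    have len: "length qs = S" using f(2) distinct_card[OF ps(2)] ps(1) by (simp add: qs_def)
    have "set qs \<subseteq> P" using ps f p0 by (auto simp: qs_def)
    then have "map (\<lambda>p. (p, f p)) qs \<in> ?X" using len f(3) by auto
    moreover have "f = ?dec (map (\<lambda>p. (p, f p)) qs)"
    proof
      fix p
      have "p \<in> set qs" if "f p \<noteq> 0" using that ps(1) by (auto simp: qs_def)
      then show "f p = ?dec (map (\<lambda>p. (p, f p)) qs) p"
        by (auto simp: map_of_map_restrict restrict_map_def)
    qed
    ultimately show "f \<in> ?dec ` ?X" by (rule rev_image_eqI)
  qed
  show "finite F" using sub fin finite_surj by blast
  have "card F \<le> card ?X" using sub fin surj_card_le by blast
  then show "card F \<le> (card P * card G) ^ S"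
    using P(1) G by (simp add: card_lists_length_eq card_cartesian_product)
qed

text \<open>
  Entry \<open>(i, j)\<close> of the matrix of layer \<open>l\<close> sits at position \<open>(l, i, Suc j)\<close> and entry \<open>i\<close> of
  its bias at \<open>(l, i, 0)\<close>; \<open>ws ! l\<close> is the output width of layer \<open>l\<close>.
\<close>

definition mlp_of_entries :: "nat \<Rightarrow> nat list \<Rightarrow> (nat \<times> nat \<times> nat \<Rightarrow> real) \<Rightarrow> mlp_params" where
  "mlp_of_entries d_in ws f = map (\<lambda>l.
     (Matrix.mat (ws ! l) (if l = 0 then d_in else ws ! (l - 1)) (\<lambda>(i, j). f (l, i, Suc j)),
      Matrix.vec (ws ! l) (\<lambda>i. f (l, i, 0)))) [0..<length ws]"

text \<open>A network is encoded by its list of widths and one sparse function on a common set of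
  positions for all layers. Since the budget \<open>S\<close> is shared by the layers, a single
  function spares the count of its distributions among them.\<close>

lemma card_round_mlp:
  fixes d_in d_out L W S :: nat and \<eta> B b :: real
  assumes \<eta>: "0 < \<eta>" and B: "0 \<le> B" "B \<le> b" and "1 \<le> L" "1 \<le> W" "1 \<le> d_in"
  defines "X \<equiv> round_mlp \<eta> ` mlp_class d_in d_out L W S B"
  shows "finite X" "card X \<le> W ^ L * (L * (W * (W + d_in)) * card (grid \<eta> b)) ^ S"
proof -
  \<comment> \<open>The last coordinate is 0 for a bias and the column plus one otherwise, hence at
    most the input width of the layer. This is \<open>d_in\<close> or at most \<open>W\<close>, in
    both cases strictly below \<open>W + d_in\<close>.\<close>
  define P where "P = {..<L} \<times> {..<W} \<times> {..<W + d_in}"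
  define F where "F = {f. {p. f p \<noteq> 0} \<subseteq> P \<and> card {p. f p \<noteq> 0} \<le> S \<and> f ` P \<subseteq> grid \<eta> b}"
  let ?ws = "{ws. set ws \<subseteq> {1..W} \<and> length ws = L}"
  have P: "finite P" "P \<noteq> {}" "card P = L * (W * (W + d_in))"
    using assms(4-6) by (auto simp: P_def card_cartesian_product lessThan_empty_iff)
  have fF: "finite F" "card F \<le> (card P * card (grid \<eta> b)) ^ S"
    unfolding F_def by (rule card_sparse_functions[OF P(1,2) finite_grid])+
  have fW: "finite ?ws" "card ?ws = W ^ L"
    by (auto intro: finite_lists_length_eq simp: card_lists_length_eq)
  have sub: "X \<subseteq> (\<lambda>(ws, f). mlp_of_entries d_in ws f) ` (?ws \<times> F)"
  proof
    fix \<omega> assume "\<omega> \<in> X"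
    then obtain \<omega>0 where \<omega>0: "\<omega>0 \<in> mlp_class d_in d_out L W S B" "\<omega> = round_mlp \<eta> \<omega>0"
      by (auto simp: X_def)
    have \<omega>: "\<omega> \<in> mlp_class d_in d_out L W S B" using round_mlp_class[OF \<eta> B(1) \<omega>0(1)] \<omega>0(2) by simp
    obtain w where w: "w 0 = d_in" "\<And>l. l \<in> {1..L} \<Longrightarrow> 1 \<le> w l \<and> w l \<le> W"
        and lay: "layers_in w B \<omega>0" and len0: "length \<omega>0 = L"
      using \<omega>0(1) unfolding mlp_class_iff by auto
    have len: "length \<omega> = L" by (simp add: \<omega>0(2) len0)
    define A where "A l = fst (\<omega> ! l)" for l
    define c where "c l = snd (\<omega> ! l)" for l
    have Ac: "A l \<in> carrier_mat (w (Suc l)) (w l)" "c l \<in> carrier_vec (w (Suc l))" if "l < L" for l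
      using lay that unfolding layers_in_def A_def c_def \<omega>0(2) len0
      by (auto simp: mat_box_def vec_box_def len0)
    have AG: "A l $$ (i, j) \<in> grid \<eta> b" if "l < L" "i < w (Suc l)" "j < w l" for l i j
    proof -
      have "fst (\<omega>0 ! l) \<in> mat_box (w (Suc l)) (w l) (- B) B" using lay that len0 by (auto simp: layers_in_def)
      then have "A l $$ (i, j) = grid_round \<eta> (fst (\<omega>0 ! l) $$ (i, j))" "- B \<le> fst (\<omega>0 ! l) $$ (i, j)" "fst (\<omega>0 ! l) $$ (i, j) \<le> B"
        using that by (auto simp: mat_box_def A_def \<omega>0(2) len0)
      moreover from this(2,3) have "\<bar>fst (\<omega>0 ! l) $$ (i, j)\<bar> \<le> b" using B(2) by linarith
      ultimately show ?thesis using grid_round_in_grid[OF \<eta>] by simp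
    qed
    have cG: "c l $ i \<in> grid \<eta> b" if "l < L" "i < w (Suc l)" for l i
    proof -
      have "snd (\<omega>0 ! l) \<in> vec_box (w (Suc l)) (- B) B" using lay that len0 by (auto simp: layers_in_def)
      then have "c l $ i = grid_round \<eta> (snd (\<omega>0 ! l) $ i)" "- B \<le> snd (\<omega>0 ! l) $ i" "snd (\<omega>0 ! l) $ i \<le> B"
        using that by (auto simp: vec_box_def c_def \<omega>0(2) len0)
      moreover from this(2,3) have "\<bar>snd (\<omega>0 ! l) $ i\<bar> \<le> b" using B(2) by linarith
      ultimately show ?thesis using grid_round_in_grid[OF \<eta>] by simp
    qed
    define ws where "ws = map (\<lambda>l. w (Suc l)) [0..<L]"
    define f where "f = (\<lambda>(l, i, j). if l < L \<and> i < w (Suc l) then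
        (case j of 0 \<Rightarrow> c l $ i | Suc j \<Rightarrow> if j < w l then A l $$ (i, j) else 0) else 0)"
    have ws: "ws \<in> ?ws" using w(2) by (force simp: ws_def)
    have eq: "\<omega> = mlp_of_entries d_in ws f"
    proof (rule nth_equalityI)
      show "length \<omega> = length (mlp_of_entries d_in ws f)" by (simp add: mlp_of_entries_def len ws_def)
      fix l assume "l < length \<omega>"
      then have l: "l < L" by (simp add: len)
      have "A l = Matrix.mat (w (Suc l)) (w l) (\<lambda>(i, j). f (l, i, Suc j))"
        using Ac[OF l] l by (intro eq_matI) (auto simp: f_def)
      moreover have "c l = Matrix.vec (w (Suc l)) (\<lambda>i. f (l, i, 0))"
        using Ac[OF l] l by (intro eq_vecI) (auto simp: f_def)
      moreover have "mlp_of_entries d_in ws f ! l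
          = (Matrix.mat (w (Suc l)) (w l) (\<lambda>(i, j). f (l, i, Suc j)), Matrix.vec (w (Suc l)) (\<lambda>i. f (l, i, 0)))"
        using l w(1) by (cases l) (simp_all add: mlp_of_entries_def ws_def)
      ultimately show "\<omega> ! l = mlp_of_entries d_in ws f ! l"
        by (metis A_def c_def prod.collapse)
    qed
    have wle: "w (Suc l) \<le> W" if "l < L" for l using w(2)[of "Suc l"] that by simp
    have wle': "w l < W + d_in" if "l < L" for l
      using w(1) w(2)[of l] that assms(5,6) by (cases "l = 0") simp_all
    have "f \<in> F"
    proof -
      let ?SA = "\<lambda>l. {(i, j). i < dim_row (A l) \<and> j < dim_col (A l) \<and> A l $$ (i, j) \<noteq> 0}"
      let ?Sc = "\<lambda>l. {i. i < dim_vec (c l) \<and> c l $ i \<noteq> 0}"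
      have finSA: "finite (?SA l)" for l
        by (rule finite_subset[of _ "{..<dim_row (A l)} \<times> {..<dim_col (A l)}"]) auto
      have supp: "{p. f p \<noteq> 0} \<subseteq> P"
      proof clarify
        fix l i j assume "f (l, i, j) \<noteq> 0"
        then have "l < L" "i < w (Suc l)" "j = 0 \<or> j - 1 < w l"
          by (auto simp: f_def split: if_splits nat.splits)
        then show "(l, i, j) \<in> P" using wle[of l] wle'[of l] by (auto simp: P_def)
      qed
      have cover: "{p. f p \<noteq> 0}
          \<subseteq> (\<Union>l<L. (\<lambda>(i, j). (l, i, Suc j)) ` ?SA l \<union> (\<lambda>i. (l, i, 0)) ` ?Sc l)"
      proof clarify
        fix l i j assume a: "f (l, i, j) \<noteq> 0"
        then have l: "l < L" and i: "i < w (Suc l)" by (auto simp: f_def split: if_splits)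
        show "(l, i, j) \<in> (\<Union>l<L. (\<lambda>(i, j). (l, i, Suc j)) ` ?SA l \<union> (\<lambda>i. (l, i, 0)) ` ?Sc l)"
        proof (cases j)
          case 0
          then have "i \<in> ?Sc l" using a l i Ac[OF l] by (auto simp: f_def)
          then show ?thesis using l 0 by blast
        next
          case (Suc j')
          then have "(i, j') \<in> ?SA l" using a l i Ac[OF l] by (auto simp: f_def split: if_splits)
          then show ?thesis using l Suc by (intro UN_I[of l]) (auto intro!: image_eqI[where x = "(i, j')"])
        qed
      qed
      have "card {p. f p \<noteq> 0}
          \<le> card (\<Union>l<L. (\<lambda>(i, j). (l, i, Suc j)) ` ?SA l \<union> (\<lambda>i. (l, i, 0)) ` ?Sc l)"
        using cover finSA by (intro card_mono) auto
      also have "\<dots> \<le> (\<Sum>l<L. card ((\<lambda>(i, j). (l, i, Suc j)) ` ?SA l \<union> (\<lambda>i. (l, i, 0 :: nat)) ` ?Sc l))"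
        by (intro card_UN_le) auto
      also have "\<dots> \<le> (\<Sum>l<L. nnz_mat (A l) + nnz_vec (c l))"
      proof (rule sum_mono)
        fix l
        have "card ((\<lambda>(i, j). (l, i, Suc j)) ` ?SA l \<union> (\<lambda>i. (l, i, 0 :: nat)) ` ?Sc l)
            \<le> card ((\<lambda>(i, j). (l, i, Suc j)) ` ?SA l) + card ((\<lambda>i. (l, i, 0 :: nat)) ` ?Sc l)"
          by (rule card_Un_le)
        also have "\<dots> \<le> nnz_mat (A l) + nnz_vec (c l)"
          unfolding nnz_mat_def nnz_vec_def using finSA by (intro add_mono card_image_le) auto
        finally show "card ((\<lambda>(i, j). (l, i, Suc j)) ` ?SA l \<union> (\<lambda>i. (l, i, 0 :: nat)) ` ?Sc l)
            \<le> nnz_mat (A l) + nnz_vec (c l)" .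
      qed
      also have "\<dots> = (\<Sum>(A, b)\<leftarrow>\<omega>. nnz_mat A + nnz_vec b)"
        by (simp add: sum_list_sum_nth len A_def c_def case_prod_unfold lessThan_atLeast0)
      also have "\<dots> \<le> S" using \<omega> by (simp add: mlp_class_iff)
      finally have "card {p. f p \<noteq> 0} \<le> S" .
      moreover have "f ` P \<subseteq> grid \<eta> b"
        using AG cG zero_in_grid[OF \<eta>] B by (auto simp: f_def split: nat.splits)
      ultimately show ?thesis using supp by (simp add: F_def)
    qed
    with ws eq show "\<omega> \<in> (\<lambda>(ws, f). mlp_of_entries d_in ws f) ` (?ws \<times> F)"
      by (intro image_eqI[of _ _ "(ws, f)"]) auto
  qed
  have fin: "finite (?ws \<times> F)" using fW fF by simp
  show "finite X" using sub fin finite_surj by blast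
  have "card X \<le> card (?ws \<times> F)" using sub fin surj_card_le by blast
  also have "\<dots> = W ^ L * card F" by (simp only: card_cartesian_product fW)
  also have "\<dots> \<le> W ^ L * (card P * card (grid \<eta> b)) ^ S" using fF by simp
  finally show "card X \<le> W ^ L * (L * (W * (W + d_in)) * card (grid \<eta> b)) ^ S"
    by (simp add: P(3))
qed

text \<open>The radius \<open>1 + B\<close> covers both the unit interval and the interval from
  \<open>- B\<close> to \<open>B\<close>, so one grid serves every parameter. Only the network is
  counted by sparsity; the other parameters are dense and contribute one factor \<open>g\<close> per
  entry.\<close>

lemma card_round_params:
  fixes D M de L W S :: nat and \<eta> B :: real
  assumes \<eta>: "0 < \<eta>" and B: "0 \<le> B" and "1 \<le> L" "1 \<le> W" "1 \<le> D"
  defines "X \<equiv> map_prod (round_vec \<eta>) (round_params \<eta>) ` (Phi_set de \<times> Psi_set D M de L W S B)"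
  defines "g \<equiv> card (grid \<eta> (1 + B))"
  shows "finite X"
    "card X \<le> g ^ de * (g ^ (M * de) * (g ^ (D * de) * (g ^ D * (W ^ L * (L * (W * (W + D)) * g) ^ S))))"
proof -
  let ?G = "grid \<eta> (1 + B)"
  have vec: "round_vec \<eta> ` vec_box m lo hi \<subseteq> {v \<in> carrier_vec m. \<forall>i<m. v $ i \<in> ?G}"
    if "- (1 + B) \<le> lo" "hi \<le> 1 + B" for m lo hi
    using that by (auto simp: vec_box_def intro!: grid_round_in_grid[OF \<eta>]) force
  have mat: "round_mat \<eta> ` mat_box m k lo hi \<subseteq> {A \<in> carrier_mat m k. \<forall>i<m. \<forall>j<k. A $$ (i, j) \<in> ?G}"
    if "- (1 + B) \<le> lo" "hi \<le> 1 + B" for m k lo hi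
    using that by (auto simp: mat_box_def intro!: grid_round_in_grid[OF \<eta>]) force
  note v = card_vec_entries[OF finite_grid vec] and m = card_mat_entries[OF finite_grid mat]
  note r = card_round_mlp[OF \<eta> B, of "1 + B" L W D M S]
  let ?Y = "round_vec \<eta> ` vec_box de 0 1 \<times> round_mat \<eta> ` mat_box M de 0 1
      \<times> round_mat \<eta> ` mat_box D de (- B) B \<times> round_vec \<eta> ` vec_box D (- B) B
      \<times> round_mlp \<eta> ` mlp_class D M L W S B"
  have sub: "X \<subseteq> ?Y"
    unfolding X_def Phi_set_def Psi_set_def round_params_def by auto
  have fin: "finite ?Y"
    using v(1)[of 0 1 de] v(1)[of "- B" B D] m(1)[of 0 1 M de] m(1)[of "- B" B D de] r(1) assms(2-5)
    by (intro finite_cartesian_product) auto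
  show "finite X" using sub fin finite_subset by blast
  have "card X \<le> card ?Y" using sub fin card_mono by blast
  also have "\<dots> \<le> g ^ de * (g ^ (M * de) * (g ^ (D * de) * (g ^ D * (W ^ L * (L * (W * (W + D)) * g) ^ S))))"
    unfolding card_cartesian_product g_def
    using v(2)[of 0 1 de] v(2)[of "- B" B D] m(2)[of 0 1 M de] m(2)[of "- B" B D de] r(2) assms(2-5)
    by (intro mult_mono) auto
  finally show "card X \<le> g ^ de * (g ^ (M * de) * (g ^ (D * de) * (g ^ D * (W ^ L * (L * (W * (W + D)) * g) ^ S))))" .
qed

subsection \<open>The joint distribution\<close>

lemma pmf_joint_pmf:
  assumes "x \<in> token_seqs D M" "\<psi> \<in> Psi_set D M de L W S B" "1 \<le> L" "1 \<le> M"
  shows "pmf (joint_pmf D M de pY \<phi> \<psi>) (x, k) = pmf pY k * ar_prob D de (\<phi> k) \<psi> x"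
proof -
  let ?f = "\<lambda>k'. map_pmf (\<lambda>x. (x, k')) (ar_pmf D M de (\<phi> k') \<psi>)"
  have "pmf (?f k') (x, k) = 0" if "k' \<noteq> k" for k'
    using that by (intro pmf_map_outside) auto
  then have "(\<integral>k'. pmf (?f k') (x, k) \<partial>measure_pmf pY) = (\<Sum>k'\<in>{k}. pmf (?f k') (x, k) * pmf pY k')"
    by (intro integral_measure_pmf_real) auto
  moreover have "pmf (?f k) (x, k) = pmf (ar_pmf D M de (\<phi> k) \<psi>) x"
    by (rule pmf_map_inj') (auto simp: inj_def)
  ultimately show ?thesis
    using assms(1) by (simp add: joint_pmf_def pmf_bind pmf_ar_pmf[OF assms(2-4)])
qed

lemma set_joint_pmf:
  assumes "set_pmf pY \<subseteq> {1..K}" "\<psi> \<in> Psi_set D M de L W S B" "1 \<le> L" "1 \<le> M"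
  shows "set_pmf (joint_pmf D M de pY \<phi> \<psi>) \<subseteq> token_seqs D M \<times> {1..K}"
proof -
  have "set_pmf (ar_pmf D M de (\<phi> k) \<psi>) \<subseteq> token_seqs D M" for k
    using pmf_ar_pmf[OF assms(2-4)] by (auto simp: set_pmf_iff split: if_splits)
  then show ?thesis using assms(1) by (fastforce simp: joint_pmf_def)
qed

text \<open>Both joint laws have the marginal \<open>pY\<close>, so its weights can be moved inside
  the absolute values. This reduces the conditional problem to the estimates for a single
  distribution.\<close>

lemma avg_tv_eq_joint:
  fixes K :: nat
  assumes "set_pmf pY \<subseteq> {1..K}" "finite X"
  shows "avg_tv X pY p q = 1 / 2 * (\<Sum>(x, k)\<in>X \<times> {1..K}. \<bar>pmf pY k * p x k - pmf pY k * q x k\<bar>)"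
proof -
  have "avg_tv X pY p q = (\<Sum>k\<in>{1..K}. (1 / 2 * (\<Sum>x\<in>X. \<bar>p x k - q x k\<bar>)) * pmf pY k)"
    unfolding avg_tv_def using assms(1) by (intro integral_measure_pmf_real) auto
  also have "\<dots> = 1 / 2 * (\<Sum>k\<in>{1..K}. \<Sum>x\<in>X. \<bar>pmf pY k * p x k - pmf pY k * q x k\<bar>)"
    by (simp add: sum_distrib_left sum_distrib_right right_diff_distrib[symmetric] abs_mult mult_ac)
  also have "\<dots> = 1 / 2 * (\<Sum>(x, k)\<in>X \<times> {1..K}. \<bar>pmf pY k * p x k - pmf pY k * q x k\<bar>)"
    by (subst sum.swap) (simp add: sum.cartesian_product)
  finally show ?thesis .
qed

text \<open>The label weights are the true ones, though the estimator does not know them: the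
  density serves the analysis only. The parameters form one function of the label, so that the
  rounded choices can be counted as a function space.\<close>

definition joint_density ::
  "nat \<Rightarrow> nat \<Rightarrow> nat pmf \<Rightarrow> (nat \<Rightarrow> real vec \<times> ar_params) \<Rightarrow> nat list \<times> nat \<Rightarrow> real" where
  "joint_density D de pY \<theta> = (\<lambda>(x, k). pmf pY k * ar_prob D de (fst (\<theta> k)) (snd (\<theta> k)) x)"

lemma sum_joint_density:
  assumes "set_pmf pY \<subseteq> {1..K}" "1 \<le> L" "1 \<le> M"
    and "\<And>k. k \<in> {1..K} \<Longrightarrow> snd (\<theta> k) \<in> Psi_set D M de L W S B"
  shows "(\<Sum>a\<in>token_seqs D M \<times> {1..K}. joint_density D de pY \<theta> a) = 1"
proof -
  have "(\<Sum>a\<in>token_seqs D M \<times> {1..K}. joint_density D de pY \<theta> a)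
      = (\<Sum>k\<in>{1..K}. \<Sum>x\<in>token_seqs D M. pmf pY k * ar_prob D de (fst (\<theta> k)) (snd (\<theta> k)) x)"
    unfolding joint_density_def by (subst sum.swap) (simp add: sum.cartesian_product)
  also have "\<dots> = (\<Sum>k\<in>{1..K}. pmf pY k)"
    using sum_ar_prob[OF assms(4,2,3)] by (simp add: sum_distrib_left[symmetric])
  also have "\<dots> = 1" using assms(1) by (intro sum_pmf_eq_1) auto
  finally show ?thesis .
qed

lemma joint_density_nonneg:
  assumes "1 \<le> L" "a \<in> token_seqs D M \<times> {1..K}"
    and "\<And>k. k \<in> {1..K} \<Longrightarrow> snd (\<theta> k) \<in> Psi_set D M de L W S B"
  shows "0 \<le> joint_density D de pY \<theta> a"
  using assms ar_prob_nonneg[OF assms(3,1)] by (auto simp: joint_density_def)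

section \<open>Maximum likelihood over separate models for the labels\<close>

lemma prod_power_of_bool:
  fixes f :: "'k \<Rightarrow> 'a :: comm_monoid_mult"
  assumes "finite I" "y \<in> I"
  shows "(\<Prod>k\<in>I. f k ^ of_bool (y = k)) = f y"
proof -
  have "(\<Prod>k\<in>I. f k ^ of_bool (y = k)) = (\<Prod>k\<in>I. if y = k then f k else 1)"
    by (intro prod.cong) auto
  then show ?thesis using assms by simp
qed

lemma P_single_iff:
  "p \<in> P_single K D M de L W S B \<longleftrightarrow> (\<exists>\<theta>. (\<forall>k\<in>{1..K}. \<theta> k \<in> Phi_set de \<times> Psi_set D M de L W S B)
     \<and> p = (\<lambda>x y. \<Prod>k\<in>{1..K}. ar_prob D de (fst (\<theta> k)) (snd (\<theta> k)) x ^ of_bool (y = k)))"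
proof
  assume "p \<in> P_single K D M de L W S B"
  then obtain \<phi> \<psi> where "\<forall>k\<in>{1..K}. \<phi> k \<in> Phi_set de \<and> \<psi> k \<in> Psi_set D M de L W S B"
    "p = (\<lambda>x y. \<Prod>k\<in>{1..K}. ar_prob D de (\<phi> k) (\<psi> k) x ^ of_bool (y = k))"
    unfolding P_single_def by blast
  then show "\<exists>\<theta>. (\<forall>k\<in>{1..K}. \<theta> k \<in> Phi_set de \<times> Psi_set D M de L W S B)
     \<and> p = (\<lambda>x y. \<Prod>k\<in>{1..K}. ar_prob D de (fst (\<theta> k)) (snd (\<theta> k)) x ^ of_bool (y = k))"
    by (intro exI[of _ "\<lambda>k. (\<phi> k, \<psi> k)"]) auto
next
  assume "\<exists>\<theta>. (\<forall>k\<in>{1..K}. \<theta> k \<in> Phi_set de \<times> Psi_set D M de L W S B)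
     \<and> p = (\<lambda>x y. \<Prod>k\<in>{1..K}. ar_prob D de (fst (\<theta> k)) (snd (\<theta> k)) x ^ of_bool (y = k))"
  then obtain \<theta> where "\<forall>k\<in>{1..K}. \<theta> k \<in> Phi_set de \<times> Psi_set D M de L W S B"
     "p = (\<lambda>x y. \<Prod>k\<in>{1..K}. ar_prob D de (fst (\<theta> k)) (snd (\<theta> k)) x ^ of_bool (y = k))" by blast
  then show "p \<in> P_single K D M de L W S B"
    unfolding P_single_def
    by (intro CollectI exI[of _ "\<lambda>k. fst (\<theta> k)"] exI[of _ "\<lambda>k. snd (\<theta> k)"]) (auto simp: mem_Times_iff)
qed

text \<open>On the event of the union bound the rest is deterministic. Rounding the maximizer costs
  at most a factor \<open>exp (1 / n)\<close> per sample, hence \<open>exp 1\<close> in all, which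
  is the slack built into that event. So the rounded model is within \<open>\<tau>\<close> of the
  truth, and the maximizer is within \<open>1 / n\<close> of its rounding. The exponent
  \<open>K\<close> in the bound \<open>N\<close> comes from independent choices for the
  labels.\<close>

lemma single_mle_avg_tv:
  fixes D M de L W S n K :: nat and B \<eta> \<delta> \<tau> N :: real
  assumes sizes: "1 \<le> n" "1 \<le> M" "1 \<le> L" and B: "0 \<le> B" and \<eta>: "0 < \<eta>"
    and pY: "set_pmf pY \<subseteq> {1..K}"
    and \<phi>: "\<And>k. k \<in> {1..K} \<Longrightarrow> \<phi> k \<in> Phi_set de" and \<psi>: "\<psi> \<in> Psi_set D M de L W S B"
    and err: "log_prob_error D de L W B \<eta> \<le> 1 / real n"
    and fin: "finite (map_prod (round_vec \<eta>) (round_params \<eta>) ` (Phi_set de \<times> Psi_set D M de L W S B))"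
    and N: "real (card (map_prod (round_vec \<eta>) (round_params \<eta>) ` (Phi_set de \<times> Psi_set D M de L W S B))) ^ K \<le> N"
      "0 < N"
    and \<delta>: "0 < \<delta>" and \<tau>: "0 \<le> \<tau>" "1 + 2 * ln N + 2 * ln (1 / \<delta>) \<le> real n * \<tau>\<^sup>2"
  shows "1 - \<delta> \<le> measure_pmf.prob (iid_pmf n (joint_pmf D M de pY \<phi> \<psi>))
    {s. \<forall>phat. is_mle (P_single K D M de L W S B) n s phat \<longrightarrow>
        avg_tv (token_seqs D M) pY phat (\<lambda>x k. ar_prob D de (\<phi> k) \<psi> x) \<le> \<tau> + 1 / real n}"
proof -
  define R where "R = map_prod (round_vec \<eta>) (round_params \<eta>) ` (Phi_set de \<times> Psi_set D M de L W S B)"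
  define Q where "Q = joint_density D de pY ` ({1..K} \<rightarrow>\<^sub>E R)"
  define A where "A = token_seqs D M \<times> {1..K}"
  define p where "p = joint_pmf D M de pY \<phi> \<psi>"
  have finA: "finite A" by (simp add: A_def finite_token_seqs)
  have pA: "set_pmf p \<subseteq> A" unfolding p_def A_def by (rule set_joint_pmf[OF pY \<psi> sizes(3,2)])
  have pmfp: "pmf p (x, k) = pmf pY k * ar_prob D de (\<phi> k) \<psi> x" if "(x, k) \<in> A" for x k
    unfolding p_def using that by (intro pmf_joint_pmf[OF _ \<psi> sizes(3,2)]) (auto simp: A_def)
  have finPi: "finite ({1..K} \<rightarrow>\<^sub>E R)" using fin by (intro finite_PiE) (auto simp: R_def)
  have finQ: "finite Q" unfolding Q_def using finPi by simp
  have "card Q \<le> card ({1..K} \<rightarrow>\<^sub>E R)" unfolding Q_def using finPi by (rule card_image_le)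
  also have "\<dots> = card R ^ K" by (simp add: card_PiE)
  finally have "real (card Q) \<le> real (card R) ^ K" by (metis of_nat_le_iff of_nat_power)
  then have cardQ: "real (card Q) \<le> N" using N(1) unfolding R_def by linarith
  have RPsi: "snd r \<in> Psi_set D M de L W S B" if "r \<in> R" for r
    using that round_params_Psi[OF \<eta> B] by (auto simp: R_def)
  have thPsi: "snd (\<theta> k) \<in> Psi_set D M de L W S B" if "\<theta> \<in> {1..K} \<rightarrow>\<^sub>E R" "k \<in> {1..K}" for \<theta> k
    using that by (intro RPsi) auto
  have Qsum: "(\<Sum>a\<in>A. q a) = 1" if q: "q \<in> Q" for q
  proof -
    from q obtain \<theta> where "\<theta> \<in> {1..K} \<rightarrow>\<^sub>E R" "q = joint_density D de pY \<theta>" by (auto simp: Q_def)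
    then show ?thesis
      unfolding A_def using sum_joint_density[OF pY sizes(3,2) thPsi] by simp
  qed
  have Q0: "0 \<le> q a" if "q \<in> Q" "a \<in> A" for q a
  proof -
    from that(1) obtain \<theta> where "\<theta> \<in> {1..K} \<rightarrow>\<^sub>E R" "q = joint_density D de pY \<theta>" by (auto simp: Q_def)
    then show ?thesis
      using joint_density_nonneg[OF sizes(3) that(2)[unfolded A_def] thPsi] by simp
  qed
  let ?good = "{s. \<forall>q\<in>Q. exp (- 1) * (\<Prod>i<n. pmf p (s i)) \<le> (\<Prod>i<n. q (s i))
      \<longrightarrow> 1 / 2 * (\<Sum>a\<in>A. \<bar>q a - pmf p a\<bar>) \<le> \<tau>}"
  have "1 - \<delta> \<le> measure_pmf.prob (iid_pmf n p) ?good"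
    using sizes(1) by (intro likelihood_ratio_uniform[OF finA pA finQ _ _ cardQ N(2) _ \<delta> \<tau>] Q0 Qsum) auto
  also have "\<dots> \<le> measure_pmf.prob (iid_pmf n p) {s. \<forall>phat. is_mle (P_single K D M de L W S B) n s phat \<longrightarrow>
        avg_tv (token_seqs D M) pY phat (\<lambda>x k. ar_prob D de (\<phi> k) \<psi> x) \<le> \<tau> + 1 / real n}"
  proof (intro measure_pmf.finite_measure_mono_AE)
    show "AE s in measure_pmf (iid_pmf n p). s \<in> ?good \<longrightarrow>
        s \<in> {s. \<forall>phat. is_mle (P_single K D M de L W S B) n s phat \<longrightarrow>
          avg_tv (token_seqs D M) pY phat (\<lambda>x k. ar_prob D de (\<phi> k) \<psi> x) \<le> \<tau> + 1 / real n}"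
      unfolding AE_measure_pmf_iff
    proof (intro ballI impI CollectI allI)
      fix s phat
      assume s: "s \<in> set_pmf (iid_pmf n p)" and good: "s \<in> ?good"
        and mle: "is_mle (P_single K D M de L W S B) n s phat"
      have sA: "s i \<in> A" if "i < n" for i
        using s that pA set_Pi_pmf[of "{..<n}" undefined "\<lambda>_. p"] by (auto simp: iid_pmf_def PiE_dflt_def)
      have "phat \<in> P_single K D M de L W S B" using mle by (simp add: is_mle_def is_arg_max_def)
      then obtain \<theta> where \<theta>: "\<And>k. k \<in> {1..K} \<Longrightarrow> \<theta> k \<in> Phi_set de \<times> Psi_set D M de L W S B"
          and phat: "phat = (\<lambda>x y. \<Prod>k\<in>{1..K}. ar_prob D de (fst (\<theta> k)) (snd (\<theta> k)) x ^ of_bool (y = k))"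
        unfolding P_single_iff by blast
      \<comment> \<open>The restriction places the rounded parameters in the extensional function
        space that was counted.\<close>
      define \<theta>' where "\<theta>' = restrict (\<lambda>k. map_prod (round_vec \<eta>) (round_params \<eta>) (\<theta> k)) {1..K}"
      define q where "q = joint_density D de pY \<theta>'"
      define f where "f = joint_density D de pY \<theta>"
      have f_phat: "f (x, k) = pmf pY k * phat x k" if "(x, k) \<in> A" for x k
        using that by (simp add: f_def joint_density_def phat A_def prod_power_of_bool)
      have qQ: "q \<in> Q" unfolding q_def Q_def using \<theta> by (auto simp: \<theta>'_def R_def intro!: imageI)
      have f0: "0 \<le> f a" if "a \<in> A" for a
        unfolding f_def using \<theta> that by (intro joint_density_nonneg[OF sizes(3)]) (auto simp: A_def mem_Times_iff)
      define t where "t = 1 / real n"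
      have et: "exp (log_prob_error D de L W B \<eta>) \<le> exp t" using err by (simp add: t_def)
      have fq: "f a \<le> exp t * q a" "q a \<le> exp t * f a" if a: "a \<in> A" for a
      proof -
        obtain x k where xk: "a = (x, k)" "x \<in> token_seqs D M" "k \<in> {1..K}" using a by (auto simp: A_def)
        let ?p = "ar_prob D de (fst (\<theta> k)) (snd (\<theta> k)) x"
          and ?p' = "ar_prob D de (round_vec \<eta> (fst (\<theta> k))) (round_params \<eta> (snd (\<theta> k))) x"
        have mem: "fst (\<theta> k) \<in> Phi_set de" "snd (\<theta> k) \<in> Psi_set D M de L W S B"
          using \<theta>[OF xk(3)] by (auto simp: mem_Times_iff)
        have fe: "f a = pmf pY k * ?p" and qe: "q a = pmf pY k * ?p'"
          using xk(3) by (simp_all add: f_def q_def xk(1) joint_density_def \<theta>'_def)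
        have nn: "0 \<le> ?p" "0 \<le> ?p'"
          using ar_prob_nonneg[OF mem(2) sizes(3) xk(2)]
            ar_prob_nonneg[OF round_params_Psi[OF \<eta> B mem(2)] sizes(3) xk(2)] by blast+
        note r = ar_prob_round[OF \<eta> B mem xk(2) sizes(3)]
        have "?p \<le> exp t * ?p'" "?p' \<le> exp t * ?p"
          using r mult_right_mono[OF et nn(1)] mult_right_mono[OF et nn(2)] by linarith+
        from this[THEN mult_left_mono, OF pmf_nonneg[of pY k]]
        show "f a \<le> exp t * q a" "q a \<le> exp t * f a" unfolding fe qe by (simp_all add: mult_ac)
      qed
      have pmfeq: "pmf p a = pmf pY (snd a) * ar_prob D de (\<phi> (snd a)) \<psi> (fst a)" if "a \<in> A" for a
        using pmfp[of "fst a" "snd a"] that by simp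
      let ?pstar = "\<lambda>x y. \<Prod>k\<in>{1..K}. ar_prob D de (\<phi> k) \<psi> x ^ of_bool (y = k)"
      \<comment> \<open>The truth shares one \<open>\<psi>\<close> among all labels, but it is a
        member of the larger class with separate parameters, so the maximizer has at least its
        likelihood.\<close>
      have "?pstar \<in> P_single K D M de L W S B"
        using \<phi> \<psi> unfolding P_single_iff by (intro exI[of _ "\<lambda>k. (\<phi> k, \<psi>)"]) auto
      with mle have opt: "(\<Prod>i<n. ?pstar (fst (s i)) (snd (s i))) \<le> (\<Prod>i<n. phat (fst (s i)) (snd (s i)))"
        unfolding is_mle_def is_arg_max_def by (meson not_le)
      have "(\<Prod>i<n. pmf p (s i)) = (\<Prod>i<n. pmf pY (snd (s i))) * (\<Prod>i<n. ?pstar (fst (s i)) (snd (s i)))"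
        unfolding prod.distrib[symmetric]
      proof (rule prod.cong)
        fix i assume "i \<in> {..<n}"
        then have "s i \<in> A" using sA by simp
        then show "pmf p (s i) = pmf pY (snd (s i)) * ?pstar (fst (s i)) (snd (s i))"
          by (subst pmfeq) (auto simp: A_def prod_power_of_bool)
      qed simp
      also have "\<dots> \<le> (\<Prod>i<n. pmf pY (snd (s i))) * (\<Prod>i<n. phat (fst (s i)) (snd (s i)))"
        using opt by (intro mult_left_mono prod_nonneg) auto
      also have "\<dots> = (\<Prod>i<n. f (s i))"
        unfolding prod.distrib[symmetric] using sA by (intro prod.cong refl) (metis f_phat lessThan_iff prod.collapse)
      also have "\<dots> \<le> (\<Prod>i<n. exp t * q (s i))"
        using sA f0 fq by (intro prod_mono) auto
      also have "\<dots> = exp 1 * (\<Prod>i<n. q (s i))"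
        using sizes(1) by (simp add: prod.distrib exp_of_nat_mult[symmetric] t_def)
      finally have "exp (- 1) * (\<Prod>i<n. pmf p (s i)) \<le> (\<Prod>i<n. q (s i))"
        by (simp add: exp_minus field_simps)
      with good qQ have tv: "1 / 2 * (\<Sum>a\<in>A. \<bar>q a - pmf p a\<bar>) \<le> \<tau>" by blast
      have fqabs: "\<bar>f a - q a\<bar> \<le> (exp t - 1) * q a" if a: "a \<in> A" for a
      proof -
        have q0: "0 \<le> q a" using Q0[OF qQ a] .
        have "exp (- t) * q a \<le> f a" using fq(2)[OF a] by (simp add: exp_minus field_simps)
        \<comment> \<open>Since \<open>1 - exp (- t)\<close> is at most \<open>exp t - 1\<close>,
          the lower deviation obeys the same bound as the upper one.\<close>
        moreover have "2 \<le> exp t + exp (- t)"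
          using exp_ge_add_one_self[of t] exp_ge_add_one_self[of "- t"] by linarith
        then have "2 * q a \<le> (exp t + exp (- t)) * q a" using q0 by (intro mult_right_mono)
        ultimately show ?thesis using fq(1)[OF a] by (simp add: algebra_simps abs_le_iff)
      qed
      have "(\<Sum>a\<in>A. \<bar>f a - q a\<bar>) \<le> (\<Sum>a\<in>A. (exp t - 1) * q a)" using fqabs by (rule sum_mono)
      also have "\<dots> = exp t - 1" using Qsum[OF qQ] by (simp add: sum_distrib_left[symmetric])
      \<comment> \<open>The quadratic bound on the exponential gives \<open>t\<close> plus the
        square of \<open>t\<close>, and \<open>t \<le> 1\<close>; the factor \<open>1 / 2\<close> of
        total variation then leaves exactly \<open>t\<close>.\<close>
      also have "\<dots> \<le> 2 * t"
      proof -
        have t01: "0 \<le> t" "t \<le> 1" using sizes(1) by (auto simp: t_def)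
        then have "t\<^sup>2 \<le> t" by (simp add: power2_eq_square mult_le_one mult_left_le)
        then show ?thesis using exp_bound[OF t01] by linarith
      qed
      finally have fqsum: "1 / 2 * (\<Sum>a\<in>A. \<bar>f a - q a\<bar>) \<le> t" by simp
      have "avg_tv (token_seqs D M) pY phat (\<lambda>x k. ar_prob D de (\<phi> k) \<psi> x) = 1 / 2 * (\<Sum>a\<in>A. \<bar>f a - pmf p a\<bar>)"
        unfolding avg_tv_eq_joint[OF pY finite_token_seqs] A_def[symmetric]
        by (intro arg_cong[where f = "\<lambda>u. 1 / 2 * u"] sum.cong refl) (auto simp: f_phat pmfp)
      also have "\<dots> \<le> 1 / 2 * (\<Sum>a\<in>A. \<bar>f a - q a\<bar> + \<bar>q a - pmf p a\<bar>)"
        by (intro mult_left_mono sum_mono) auto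
      also have "\<dots> \<le> \<tau> + 1 / real n" using tv fqsum by (simp add: sum.distrib t_def)
      finally show "avg_tv (token_seqs D M) pY phat (\<lambda>x k. ar_prob D de (\<phi> k) \<psi> x) \<le> \<tau> + 1 / real n" .
    qed
  qed auto
  finally show ?thesis by (simp only: p_def)
qed

section \<open>Choice of the grid width and size of the cover\<close>

lemma card_round_params_le_power:
  fixes D M de L W S n :: nat and B T :: real
  assumes sizes: "1 \<le> n" "1 \<le> D" "1 \<le> L" "1 \<le> W" and B: "0 \<le> B"
    and T: "2 + real n + real D + real de + real L + real W + B \<le> T"
  obtains \<eta> where "0 < \<eta>" "log_prob_error D de L W B \<eta> = 1 / real n"
    "finite (map_prod (round_vec \<eta>) (round_params \<eta>) ` (Phi_set de \<times> Psi_set D M de L W S B))"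
    "real (card (map_prod (round_vec \<eta>) (round_params \<eta>) ` (Phi_set de \<times> Psi_set D M de L W S B)))
       \<le> T ^ (10 * L * (de + M * de + D * de + D) + L + S * (3 + 10 * L))"
proof -
  \<comment> \<open>With these abbreviations \<open>log_prob_error\<close> equals
    \<open>2 * D * Q ^ L * a * \<eta>\<close>, so \<open>\<eta> = 1 / Y\<close> is the solution of
    error equal to \<open>1 / n\<close>. Everything below bounds \<open>Y\<close> by a power of
    \<open>T\<close>.\<close>
  define a where "a = 2 * (real de + 1) * (1 + B) + real L"
  define Q where "Q = (real (W + D) + 1) * (1 + B)"
  define Y where "Y = 2 * real n * real D * (Q ^ L * a)"
  define \<eta> where "\<eta> = 1 / Y"
  define g where "g = card (grid \<eta> (1 + B))"
  have T3: "3 \<le> T" and T1: "1 \<le> T" and T0: "0 \<le> T" using T sizes B by auto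
  have le: "real n \<le> T" "real D \<le> T" "real L \<le> T" "real W \<le> T" "real de + 1 \<le> T" "1 + B \<le> T"
      "real (W + D) + 1 \<le> T" "real (W + D) \<le> T"
    using T sizes B by auto
  have Q: "0 < Q" "Q \<le> T\<^sup>2"
    unfolding Q_def power2_eq_square using B le T0 by (auto intro!: mult_mono mult_pos_pos)
  have a0: "0 < a" using sizes B by (simp add: a_def add_nonneg_pos)
  have "a \<le> 2 * (T * T) + T * T"
  proof -
    have "(real de + 1) * (1 + B) \<le> T * T" using B le T0 by (intro mult_mono) auto
    moreover have "real L \<le> T * T" using le(3) T1 mult_right_mono[OF T1 T0] by linarith
    ultimately show ?thesis unfolding a_def mult.assoc by linarith
  qed
  also have "\<dots> \<le> T ^ 3" using T3 T0 by (simp add: power3_eq_cube mult_right_mono)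
  finally have a: "a \<le> T ^ 3" .
  have Y0: "0 < Y" using sizes Q a0 by (simp add: Y_def)
  have "Y \<le> T * T * T * ((T\<^sup>2) ^ L * T ^ 3)"
    unfolding Y_def using Q a a0 le T3 T0 by (intro mult_mono power_mono) auto
  also have "\<dots> = T ^ (2 * L + 6)"
    by (simp add: power_add power_mult[symmetric] power3_eq_cube eval_nat_numeral algebra_simps)
  finally have Y: "Y \<le> T ^ (2 * L + 6)" .
  have \<eta>: "0 < \<eta>" using Y0 by (simp add: \<eta>_def)
  have err: "log_prob_error D de L W B \<eta> = 1 / real n"
  proof -
    have "log_prob_error D de L W B \<eta> = 2 * real D * (Q ^ L * a) * \<eta>"
      by (simp add: log_prob_error_def Q_def a_def algebra_simps)
    also have "\<dots> = 1 / real n" using sizes Q a0 by (simp add: \<eta>_def Y_def)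
    finally show ?thesis .
  qed
  have "real g \<le> 2 * (1 + B) * Y + 1"
    using card_grid[OF \<eta>, of "1 + B"] B by (simp add: g_def \<eta>_def)
  also have "\<dots> \<le> 2 * T * T ^ (2 * L + 6) + T * T ^ (2 * L + 6)"
  proof (intro add_mono mult_mono)
    show "1 \<le> T * T ^ (2 * L + 6)" using one_le_power[OF T1, of "Suc (2 * L + 6)"] by (simp only: power_Suc)
  qed (use B le Y Y0 T0 in auto)
  also have "\<dots> = 3 * T ^ (2 * L + 7)" by (simp add: eval_nat_numeral algebra_simps)
  also have "\<dots> \<le> T * T ^ (2 * L + 7)" using T3 T0 by (intro mult_right_mono) auto
  also have "\<dots> = T ^ (2 * L + 8)" by (simp add: eval_nat_numeral algebra_simps)
  \<comment> \<open>The offset 8 is absorbed using \<open>1 \<le> L\<close>. Thus every grid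
    coordinate contributes \<open>10 * L\<close> to the exponent, and a nonzero network entry
    contributes 3 more for its position.\<close>
  also have "\<dots> \<le> T ^ (10 * L)" using T1 sizes by (intro power_increasing) auto
  finally have g: "real g \<le> T ^ (10 * L)" .
  have P: "real (L * (W * (W + D))) \<le> T ^ 3"
    unfolding of_nat_mult power3_eq_cube mult.assoc using le T0 by (intro mult_mono) auto
  have "real (card (map_prod (round_vec \<eta>) (round_params \<eta>) ` (Phi_set de \<times> Psi_set D M de L W S B)))
      \<le> real (g ^ de * (g ^ (M * de) * (g ^ (D * de) * (g ^ D * (W ^ L * (L * (W * (W + D)) * g) ^ S)))))"
    using card_round_params(2)[OF \<eta> B sizes(3,4,2)] unfolding g_def of_nat_le_iff .
  also have "\<dots> = real g ^ de * (real g ^ (M * de) * (real g ^ (D * de) * (real g ^ D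
      * (real W ^ L * (real (L * (W * (W + D))) * real g) ^ S))))"
    by (simp only: of_nat_mult of_nat_power)
  also have "\<dots> \<le> (T ^ (10 * L)) ^ de * ((T ^ (10 * L)) ^ (M * de) * ((T ^ (10 * L)) ^ (D * de) * ((T ^ (10 * L)) ^ D
      * (T ^ L * (T ^ 3 * T ^ (10 * L)) ^ S))))"
    using g P le T0 by (intro mult_mono power_mono) auto
  also have "\<dots> = T ^ (10 * L * (de + M * de + D * de + D) + L + S * (3 + 10 * L))"
    unfolding power_mult[symmetric] power_add[symmetric]
    by (rule arg_cong[where f = "\<lambda>m. T ^ m"]) (simp add: algebra_simps)
  finally show ?thesis using that[OF \<eta> err] card_round_params(1)[OF \<eta> B sizes(3,4,2)] by blast
qed

section \<open>The rate with explicit constants\<close>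

theorem theoremC8:
  shows "\<exists>C c :: real. C > 0 \<and> c > 0 \<and>
    (\<forall>(n::nat) (K::nat) (D::nat) (M::nat) (de::nat) (L::nat) (W::nat) (S::nat) (B::real) (\<delta>::real)
       (pY :: nat pmf) (\<phi> :: nat \<Rightarrow> real vec) (\<psi> :: ar_params).
      n \<ge> 1 \<and> K \<ge> 1 \<and> D \<ge> 1 \<and> M \<ge> 1 \<and> de \<ge> 1 \<and> L > 0 \<and> W > 0 \<and> S > 0 \<and> B > 0 \<and>
      0 < \<delta> \<and> \<delta> \<le> 1 / 2 \<and>
      set_pmf pY \<subseteq> {1..K} \<and>
      (\<forall>k\<in>{1..K}. \<phi> k \<in> Phi_set de) \<and> \<psi> \<in> Psi_set D M de L W S B \<longrightarrow>
      measure_pmf.prob (iid_pmf n (joint_pmf D M de pY \<phi> \<psi>))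
        {s. \<forall>phat. is_mle (P_single K D M de L W S B) n s phat \<longrightarrow>
              avg_tv (token_seqs D M) pY phat (\<lambda>x k. ar_prob D de (\<phi> k) \<psi> x)
              \<le> C * sqrt (real K * real L * (real S + real D + (real D + real M + 1) * real de) / real n)
                  * ln (2 + real n + real K + real D + real M + real de + real L + real W
                          + real S + B + 1 / \<delta>) powr c}
        \<ge> 1 - \<delta>)"
\<comment> \<open>The constant 7 is 6 from \<open>\<tau>\<close> plus 1 for the term
  \<open>1 / n\<close>. The logarithm would arise under the root; taking it outside to the power 1
  is possible because \<open>ln T\<close> is at least 1.\<close>
proof (rule exI[of _ 7], rule exI[of _ 1], intro conjI allI impI)
  fix n K D M de L W S :: nat and B \<delta> :: real and pY :: "nat pmf"
    and \<phi> :: "nat \<Rightarrow> real vec" and \<psi> :: ar_params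
  assume "n \<ge> 1 \<and> K \<ge> 1 \<and> D \<ge> 1 \<and> M \<ge> 1 \<and> de \<ge> 1 \<and> L > 0 \<and> W > 0 \<and> S > 0 \<and> B > 0 \<and>
      0 < \<delta> \<and> \<delta> \<le> 1 / 2 \<and> set_pmf pY \<subseteq> {1..K} \<and>
      (\<forall>k\<in>{1..K}. \<phi> k \<in> Phi_set de) \<and> \<psi> \<in> Psi_set D M de L W S B"
  then have sizes: "1 \<le> n" "1 \<le> K" "1 \<le> D" "1 \<le> M" "1 \<le> de" "1 \<le> L" "1 \<le> W" "1 \<le> S" and B: "0 < B"
    and \<delta>: "0 < \<delta>" "\<delta> \<le> 1 / 2" and pY: "set_pmf pY \<subseteq> {1..K}"
    and \<phi>: "\<And>k. k \<in> {1..K} \<Longrightarrow> \<phi> k \<in> Phi_set de" and \<psi>: "\<psi> \<in> Psi_set D M de L W S B"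
    by auto
  define T where "T = 2 + real n + real K + real D + real M + real de + real L + real W
                          + real S + B + 1 / \<delta>"
  define H where "H = real S + real D + (real D + real M + 1) * real de"
  define G where "G = real K * real L * H"
  define E where "E = 10 * L * (de + M * de + D * de + D) + L + S * (3 + 10 * L)"
  define \<tau> where "\<tau> = 6 * sqrt (G / real n) * ln T"
  have \<delta>': "0 < 1 / \<delta>" using \<delta> by simp
  have T3: "3 \<le> T" and T\<delta>: "1 / \<delta> \<le> T"
    and Tn: "2 + real n + real D + real de + real L + real W + B \<le> T"
    using sizes B \<delta>' unfolding T_def by linarith+
  have "exp 1 \<le> T" using exp_le T3 by linarith
  then have lnT: "1 \<le> ln T" using T3 by (subst ln_ge_iff) auto
  have H1: "1 \<le> H" using sizes by (simp add: H_def add_increasing2)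
  have KL: "1 \<le> real K * real L" using sizes mult_mono[of 1 "real K" 1 "real L"] by simp
  have G1: "1 \<le> G" using mult_mono[OF KL H1] by (simp add: G_def)
  obtain \<eta> where \<eta>: "0 < \<eta>" "log_prob_error D de L W B \<eta> = 1 / real n"
      "finite (map_prod (round_vec \<eta>) (round_params \<eta>) ` (Phi_set de \<times> Psi_set D M de L W S B))"
      "real (card (map_prod (round_vec \<eta>) (round_params \<eta>) ` (Phi_set de \<times> Psi_set D M de L W S B))) \<le> T ^ E"
    using card_round_params_le_power[OF sizes(1,3,6,7) less_imp_le[OF B] Tn, of M S] unfolding E_def by blast
  \<comment> \<open>The dense parameters number \<open>H - S\<close>. Then \<open>1 \<le> L\<close>
    lets the remaining \<open>3 * S\<close> take a factor \<open>L\<close>, and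
    \<open>S \<le> H\<close> with \<open>1 \<le> H\<close> gives
    \<open>10 + 1 + 3 = 14\<close>.\<close>
  have "real E = real L * (10 * (H - real S) + 1 + 10 * real S) + 3 * real S"
    by (simp add: E_def H_def algebra_simps)
  also have "\<dots> \<le> real L * (10 * (H - real S) + 1 + 10 * real S) + real L * (3 * real S)"
    using sizes mult_right_mono[of 1 "real L" "3 * real S"] by simp
  also have "\<dots> = real L * (10 * H + 1 + 3 * real S)" by (simp add: algebra_simps)
  also have "\<dots> \<le> real L * (14 * H)"
  proof (rule mult_left_mono)
    have "real S \<le> H" by (simp add: H_def)
    then show "10 * H + 1 + 3 * real S \<le> 14 * H" using H1 by linarith
  qed simp
  finally have "real K * real E \<le> real K * (real L * (14 * H))" by (intro mult_left_mono) auto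
  then have KE: "real K * real E \<le> 14 * G" by (simp add: G_def mult_ac)
  have cond: "1 + 2 * ln (T ^ (E * K)) + 2 * ln (1 / \<delta>) \<le> real n * \<tau>\<^sup>2"
  proof -
    have "ln (T ^ (E * K)) = (real K * real E) * ln T" using T3 by (simp add: ln_realpow mult_ac)
    also have "\<dots> \<le> 14 * G * ln T" using KE lnT by (intro mult_right_mono) auto
    finally have 1: "ln (T ^ (E * K)) \<le> 14 * G * ln T" .
    have Gl: "ln T \<le> G * ln T" using G1 lnT mult_right_mono[of 1 G "ln T"] by simp
    have 2: "ln (1 / \<delta>) \<le> ln T" using T\<delta> \<delta> T3 by (subst ln_le_cancel_iff) auto
    have "G * ln T \<le> G * (ln T * ln T)"
      using G1 lnT mult_right_mono[of 1 "ln T" "ln T"] by (intro mult_left_mono) auto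
    \<comment> \<open>The left side of the condition is at most \<open>1 + 28 + 2 = 31\<close> times
      \<open>G * (ln T * ln T)\<close>, which the square of 6 covers.\<close>
    moreover have "real n * \<tau>\<^sup>2 = 36 * (G * (ln T * ln T))"
      using G1 sizes by (simp add: \<tau>_def power_mult_distrib power2_eq_square[of "ln T"])
    ultimately show ?thesis using 1 2 Gl lnT G1 by linarith
  qed
  have \<tau>0: "0 \<le> \<tau>" using G1 lnT by (simp add: \<tau>_def)
  have card: "real (card (map_prod (round_vec \<eta>) (round_params \<eta>) ` (Phi_set de \<times> Psi_set D M de L W S B))) ^ K
      \<le> T ^ (E * K)"
    using \<eta>(4) unfolding power_mult by (intro power_mono) auto
  have "1 - \<delta> \<le> measure_pmf.prob (iid_pmf n (joint_pmf D M de pY \<phi> \<psi>))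
    {s. \<forall>phat. is_mle (P_single K D M de L W S B) n s phat \<longrightarrow>
        avg_tv (token_seqs D M) pY phat (\<lambda>x k. ar_prob D de (\<phi> k) \<psi> x) \<le> \<tau> + 1 / real n}"
    by (rule single_mle_avg_tv[OF sizes(1,4,6) less_imp_le[OF B] \<eta>(1) pY \<phi> \<psi> _ \<eta>(3) card _ \<delta>(1) \<tau>0 cond])
      (use \<eta>(2) T3 in auto)
  also have "\<dots> \<le> measure_pmf.prob (iid_pmf n (joint_pmf D M de pY \<phi> \<psi>))
    {s. \<forall>phat. is_mle (P_single K D M de L W S B) n s phat \<longrightarrow>
        avg_tv (token_seqs D M) pY phat (\<lambda>x k. ar_prob D de (\<phi> k) \<psi> x)
          \<le> 7 * sqrt (G / real n) * ln T powr 1}"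
  proof -
    \<comment> \<open>Since \<open>1 \<le> G\<close>, the rounding error \<open>1 / n\<close> is of
      lower order than the rate and fits into one further copy of it.\<close>
    have "(1 / real n)\<^sup>2 \<le> G / real n"
    proof -
      have "(1 / real n)\<^sup>2 \<le> 1 / real n" using sizes by (simp add: power2_eq_square field_simps)
      also have "\<dots> \<le> G / real n" using G1 by (intro divide_right_mono) auto
      finally show ?thesis .
    qed
    then have "1 / real n \<le> sqrt (G / real n)" by (intro real_le_rsqrt)
    also have "\<dots> \<le> sqrt (G / real n) * ln T"
      using G1 lnT mult_left_mono[of 1 "ln T" "sqrt (G / real n)"] by simp
    finally have "\<tau> + 1 / real n \<le> 7 * sqrt (G / real n) * ln T powr 1"
      using lnT by (simp add: \<tau>_def mult_ac)
    then show ?thesis by (intro measure_pmf.finite_measure_mono) (auto intro: order_trans)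
  qed
  finally show "measure_pmf.prob (iid_pmf n (joint_pmf D M de pY \<phi> \<psi>))
        {s. \<forall>phat. is_mle (P_single K D M de L W S B) n s phat \<longrightarrow>
              avg_tv (token_seqs D M) pY phat (\<lambda>x k. ar_prob D de (\<phi> k) \<psi> x)
              \<le> 7 * sqrt (real K * real L * (real S + real D + (real D + real M + 1) * real de) / real n)
                  * ln (2 + real n + real K + real D + real M + real de + real L + real W
                          + real S + B + 1 / \<delta>) powr 1}
        \<ge> 1 - \<delta>"
    by (simp only: G_def H_def T_def)
qed auto

end
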